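(* Let $(\mathfrak{g},[\cdot,\ldots,\cdot],\alpha)$ be a multiplicative $(n+1)$-ary Hom-Nambu algebra and let $D_n(\mathfrak{g})=\mathfrak{g}^{\otimes n}$. (1) $D_n(\mathfrak{g})$ is a Leibniz algebra with respect to the bracket $$[a_1\otimes\cdots\otimes a_n,\,b_1\otimes\cdots\otimes b_n]=\sum_{i=1}^n a_1\otimes\cdots\otimes a_{i-1}\otimes[a_i,b_1,\ldots,b_n]\otimes a_{i+1}\otimes\cdots\otimes a_n.$$ (2) Moreover, if one instead defines the bracket by $$[a_1\otimes\cdots\otimes a_n,\,b_1\otimes\cdots\otimes b_n]=\sum_{i=1}^n\alpha(a_1)\otimes\cdots\otimes\alpha(a_{i-1})\otimes[a_i,b_1,\ldots,b_n]\otimes\alpha(a_{i+1})\otimes\cdots\otimes\alpha(a_n)$$ and defines $\alpha':D_n(\mathfrak{g})\to D_n(\mathfrak{g})$ by $$\alpha'(a_1\otimes\cdots\otimes a_n)=\alpha(a_1)\otimes\cdots\otimes\alpha(a_n),$$ then $(D_n(\mathfrak{g}),[\cdot,\cdot],\alpha')$ is a multiplicative Hom-Leibniz algebra.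
   Context: All vector spaces are over a fixed ground field. For $m\ge 2$, a multiplicative $m$-ary Hom-Nambu algebra is a triple $(\mathfrak{g},[\cdot,\ldots,\cdot],\alpha)$ consisting of a vector space $\mathfrak{g}$, an $m$-linear map $[\cdot,\ldots,\cdot]:\mathfrak{g}^m\to\mathfrak{g}$ (no skew-symmetry is assumed) and a linear map $\alpha:\mathfrak{g}\to\mathfrak{g}$ such that for all elements $$[[x_1,\ldots,x_m],\alpha(y_1),\ldots,\alpha(y_{m-1})]=\sum_{i=1}^m[\alpha(x_1),\ldots,\alpha(x_{i-1}),[x_i,y_1,\ldots,y_{m-1}],\alpha(x_{i+1}),\ldots,\alpha(x_m)]$$ and $\alpha([x_1,\ldots,x_m])=[\alpha(x_1),\ldots,\alpha(x_m)]$. A multiplicative Hom-Leibniz algebra is the case $m=2$: $[[x,y],\alpha(z)]=[[x,z],\alpha(y)]+[\alpha(x),[y,z]]$ and $\alpha([x,y])=[\alpha(x),\alpha(y)]$. A Leibniz algebra is a vector space with a bilinear bracket satisfying $[[x,y],z]=[[x,z],y]+[x,[y,z]]$ for all elements. The brackets on $D_n(\mathfrak{g})$ are extended bilinearly, and $\alpha'$ linearly, from decomposable tensors.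
   Formalization: In part (1) the Leibniz property is claimed only when the bracket also satisfies the untwisted Nambu identity (the case α = id of the identity); as worded it fails for n = 1, g the ground field, [x,y] = xy, α = 0. *)

theory Defs
  imports "HOL-Algebra.Module" "HOL-Algebra.AbelCoset"
begin

section \<open>Vector spaces, linear and multilinear maps\<close>

definition vectorspace :: "('r, 'x) ring_scheme \<Rightarrow> ('r, 'a, 'y) module_scheme \<Rightarrow> bool" where
  "vectorspace R M \<longleftrightarrow> field R \<and> module R M"

definition linear_map ::
  "('r, 'x) ring_scheme \<Rightarrow> ('r, 'a, 'y) module_scheme \<Rightarrow> ('r, 'b, 'z) module_scheme \<Rightarrow> ('a \<Rightarrow> 'b) \<Rightarrow> bool"
where
  "linear_map R M N f \<longleftrightarrow>
     f \<in> carrier M \<rightarrow> carrier N \<and>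
     (\<forall>x\<in>carrier M. \<forall>y\<in>carrier M. f (x \<oplus>\<^bsub>M\<^esub> y) = f x \<oplus>\<^bsub>N\<^esub> f y) \<and>
     (\<forall>c\<in>carrier R. \<forall>x\<in>carrier M. f (c \<odot>\<^bsub>M\<^esub> x) = c \<odot>\<^bsub>N\<^esub> f x)"

definition bilinear_map ::
  "('r, 'x) ring_scheme \<Rightarrow> ('r, 'a, 'y) module_scheme \<Rightarrow> ('r, 'b, 'z) module_scheme \<Rightarrow>
   ('r, 'c, 'w) module_scheme \<Rightarrow> ('a \<Rightarrow> 'b \<Rightarrow> 'c) \<Rightarrow> bool"
where
  "bilinear_map R M N P B \<longleftrightarrow>
     (\<forall>x\<in>carrier M. linear_map R N P (B x)) \<and>
     (\<forall>y\<in>carrier N. linear_map R M P (\<lambda>x. B x y))"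

text \<open>An element \<open>(x\<^sub>1, \<dots>, x\<^sub>m)\<close> of \<open>M\<^sup>m\<close> is a list of length \<open>m\<close>; its entries are
  indexed from 0, and \<open>xs[i := x]\<close> replaces one entry.\<close>

definition tuples :: "('r, 'a, 'y) module_scheme \<Rightarrow> nat \<Rightarrow> 'a list set" where
  "tuples M m = {xs. length xs = m \<and> set xs \<subseteq> carrier M}"

definition multilinear_map ::
  "('r, 'x) ring_scheme \<Rightarrow> ('r, 'a, 'y) module_scheme \<Rightarrow> nat \<Rightarrow> ('r, 'b, 'z) module_scheme \<Rightarrow>
   ('a list \<Rightarrow> 'b) \<Rightarrow> bool"
where
  "multilinear_map R M m N f \<longleftrightarrow>
     f \<in> tuples M m \<rightarrow> carrier N \<and>
     (\<forall>xs\<in>tuples M m. \<forall>i<m. linear_map R M N (\<lambda>x. f (xs[i := x])))"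


section \<open>Hom-Nambu, Leibniz and Hom-Leibniz algebras\<close>

definition multiplicative_hom_nambu ::
  "('r, 'x) ring_scheme \<Rightarrow> ('r, 'a, 'y) module_scheme \<Rightarrow> nat \<Rightarrow> ('a list \<Rightarrow> 'a) \<Rightarrow> ('a \<Rightarrow> 'a) \<Rightarrow> bool"
where
  "multiplicative_hom_nambu R g m br \<alpha> \<longleftrightarrow>
     m \<ge> 2 \<and> vectorspace R g \<and> multilinear_map R g m g br \<and> linear_map R g g \<alpha> \<and>
     (\<forall>xs\<in>tuples g m. \<forall>ys\<in>tuples g (m - 1).
        br (br xs # map \<alpha> ys) = (\<Oplus>\<^bsub>g\<^esub>i\<in>{..<m}. br ((map \<alpha> xs)[i := br (xs ! i # ys)]))) \<and>
     (\<forall>xs\<in>tuples g m. \<alpha> (br xs) = br (map \<alpha> xs))"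

definition leibniz_algebra ::
  "('r, 'x) ring_scheme \<Rightarrow> ('r, 'a, 'y) module_scheme \<Rightarrow> ('a \<Rightarrow> 'a \<Rightarrow> 'a) \<Rightarrow> bool"
where
  "leibniz_algebra R L B \<longleftrightarrow>
     vectorspace R L \<and> bilinear_map R L L L B \<and>
     (\<forall>x\<in>carrier L. \<forall>y\<in>carrier L. \<forall>z\<in>carrier L. B (B x y) z = B (B x z) y \<oplus>\<^bsub>L\<^esub> B x (B y z))"

definition multiplicative_hom_leibniz ::
  "('r, 'x) ring_scheme \<Rightarrow> ('r, 'a, 'y) module_scheme \<Rightarrow> ('a \<Rightarrow> 'a \<Rightarrow> 'a) \<Rightarrow> ('a \<Rightarrow> 'a) \<Rightarrow> bool"
where
  "multiplicative_hom_leibniz R L B \<alpha> \<longleftrightarrow>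
     vectorspace R L \<and> bilinear_map R L L L B \<and> linear_map R L L \<alpha> \<and>
     (\<forall>x\<in>carrier L. \<forall>y\<in>carrier L. \<forall>z\<in>carrier L.
        B (B x y) (\<alpha> z) = B (B x z) (\<alpha> y) \<oplus>\<^bsub>L\<^esub> B (\<alpha> x) (B y z)) \<and>
     (\<forall>x\<in>carrier L. \<forall>y\<in>carrier L. \<alpha> (B x y) = B (\<alpha> x) (\<alpha> y))"


section \<open>Tensor powers\<close>

text \<open>The tensor power \<open>M\<^sup>\<otimes>\<^sup>n\<close> is the free vector space on the set \<open>M\<^sup>n\<close> modulo the
  subspace generated by the multilinearity relations. The type of records of modules extends
  that of rings; the multiplicative components are irrelevant here and left undefined.\<close>

definition free_module :: "('r, 'x) ring_scheme \<Rightarrow> 'b set \<Rightarrow> ('r, 'b \<Rightarrow> 'r) module" where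
  "free_module R S =
     \<lparr> carrier = {f. f \<in> S \<rightarrow> carrier R \<and> (\<forall>x. x \<notin> S \<longrightarrow> f x = \<zero>\<^bsub>R\<^esub>) \<and> finite {x. f x \<noteq> \<zero>\<^bsub>R\<^esub>}},
       mult = undefined, one = undefined,
       zero = (\<lambda>x. \<zero>\<^bsub>R\<^esub>), add = (\<lambda>f h x. f x \<oplus>\<^bsub>R\<^esub> h x),
       smult = (\<lambda>c f x. c \<otimes>\<^bsub>R\<^esub> f x) \<rparr>"

definition free_gen :: "('r, 'x) ring_scheme \<Rightarrow> 'b \<Rightarrow> 'b \<Rightarrow> 'r" where
  "free_gen R s = (\<lambda>x. if x = s then \<one>\<^bsub>R\<^esub> else \<zero>\<^bsub>R\<^esub>)"

definition submodule_generated ::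
  "('r, 'x) ring_scheme \<Rightarrow> ('r, 'a, 'y) module_scheme \<Rightarrow> 'a set \<Rightarrow> 'a set"
where
  "submodule_generated R M S = \<Inter>{N. submodule N R M \<and> S \<subseteq> N}"

definition quotient_module ::
  "('r, 'a, 'y) module_scheme \<Rightarrow> 'a set \<Rightarrow> ('r, 'a set) module"
where
  "quotient_module M N =
     \<lparr> carrier = a_rcosets\<^bsub>M\<^esub> N,
       mult = undefined, one = undefined,
       zero = N, add = (\<lambda>X Y. X <+>\<^bsub>M\<^esub> Y),
       smult = (\<lambda>c X. \<Union>x\<in>X. N +>\<^bsub>M\<^esub> (c \<odot>\<^bsub>M\<^esub> x)) \<rparr>"

definition tensor_free ::
  "('r, 'x) ring_scheme \<Rightarrow> ('r, 'a, 'y) module_scheme \<Rightarrow> nat \<Rightarrow> ('r, 'a list \<Rightarrow> 'r) module"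
where
  "tensor_free R M n = free_module R (tuples M n)"

definition tensor_relators ::
  "('r, 'x) ring_scheme \<Rightarrow> ('r, 'a, 'y) module_scheme \<Rightarrow> nat \<Rightarrow> ('a list \<Rightarrow> 'r) set"
where
  "tensor_relators R M n =
     {free_gen R (xs[i := x \<oplus>\<^bsub>M\<^esub> y])
        \<ominus>\<^bsub>tensor_free R M n\<^esub> (free_gen R (xs[i := x]) \<oplus>\<^bsub>tensor_free R M n\<^esub> free_gen R (xs[i := y]))
      | xs i x y. xs \<in> tuples M n \<and> i < n \<and> x \<in> carrier M \<and> y \<in> carrier M} \<union>
     {free_gen R (xs[i := c \<odot>\<^bsub>M\<^esub> x])
        \<ominus>\<^bsub>tensor_free R M n\<^esub> (c \<odot>\<^bsub>tensor_free R M n\<^esub> free_gen R (xs[i := x]))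
      | xs i c x. xs \<in> tuples M n \<and> i < n \<and> c \<in> carrier R \<and> x \<in> carrier M}"

definition tensor_kernel ::
  "('r, 'x) ring_scheme \<Rightarrow> ('r, 'a, 'y) module_scheme \<Rightarrow> nat \<Rightarrow> ('a list \<Rightarrow> 'r) set"
where
  "tensor_kernel R M n = submodule_generated R (tensor_free R M n) (tensor_relators R M n)"

definition tensor_power ::
  "('r, 'x) ring_scheme \<Rightarrow> ('r, 'a, 'y) module_scheme \<Rightarrow> nat \<Rightarrow> ('r, ('a list \<Rightarrow> 'r) set) module"
where
  "tensor_power R M n = quotient_module (tensor_free R M n) (tensor_kernel R M n)"

text \<open>The decomposable tensor \<open>x\<^sub>1 \<otimes> \<dots> \<otimes> x\<^sub>n\<close>:\<close>

definition tensor ::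
  "('r, 'x) ring_scheme \<Rightarrow> ('r, 'a, 'y) module_scheme \<Rightarrow> nat \<Rightarrow> 'a list \<Rightarrow> ('a list \<Rightarrow> 'r) set"
where
  "tensor R M n xs = tensor_kernel R M n +>\<^bsub>tensor_free R M n\<^esub> free_gen R xs"

text \<open>\<open>B\<close> is the bilinear extension to \<open>M\<^sup>\<otimes>\<^sup>n\<close> of a bracket \<open>F\<close> given on pairs of
  decomposable tensors, and \<open>A\<close> the linear extension of a map \<open>F\<close> given on decomposable tensors.\<close>

definition extends_bilinearly ::
  "('r, 'x) ring_scheme \<Rightarrow> ('r, 'a, 'y) module_scheme \<Rightarrow> nat \<Rightarrow>
   ('a list \<Rightarrow> 'a list \<Rightarrow> ('a list \<Rightarrow> 'r) set) \<Rightarrow>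
   (('a list \<Rightarrow> 'r) set \<Rightarrow> ('a list \<Rightarrow> 'r) set \<Rightarrow> ('a list \<Rightarrow> 'r) set) \<Rightarrow> bool"
where
  "extends_bilinearly R M n F B \<longleftrightarrow>
     bilinear_map R (tensor_power R M n) (tensor_power R M n) (tensor_power R M n) B \<and>
     (\<forall>as\<in>tuples M n. \<forall>bs\<in>tuples M n. B (tensor R M n as) (tensor R M n bs) = F as bs)"

definition extends_linearly ::
  "('r, 'x) ring_scheme \<Rightarrow> ('r, 'a, 'y) module_scheme \<Rightarrow> nat \<Rightarrow>
   ('a list \<Rightarrow> ('a list \<Rightarrow> 'r) set) \<Rightarrow> (('a list \<Rightarrow> 'r) set \<Rightarrow> ('a list \<Rightarrow> 'r) set) \<Rightarrow> bool"
where
  "extends_linearly R M n F A \<longleftrightarrow>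
     linear_map R (tensor_power R M n) (tensor_power R M n) A \<and>
     (\<forall>as\<in>tuples M n. A (tensor R M n as) = F as)"

text \<open>Both brackets below are well defined for every Hom-Nambu algebra, but the untwisted one,
  \<open>derivation_bracket\<close>, is a Leibniz bracket only under the untwisted Nambu identity, i.e. the
  Hom-Nambu identity with the identity map as twisting map. The identity for another \<open>\<alpha>\<close> is not
  enough: with \<open>\<alpha> = 0\<close> it holds for every multilinear bracket, and for \<open>n = 1\<close> and the ground
  field with \<open>[x, y] = x y\<close> the Leibniz identity at (1, 1, 1) would give 1 = 1 + 1.\<close>

definition derivation_bracket ::
  "('r, 'x) ring_scheme \<Rightarrow> ('r, 'a, 'y) module_scheme \<Rightarrow> nat \<Rightarrow> ('a list \<Rightarrow> 'a) \<Rightarrow>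
   'a list \<Rightarrow> 'a list \<Rightarrow> ('a list \<Rightarrow> 'r) set"
where
  "derivation_bracket R g n br as bs =
     (\<Oplus>\<^bsub>tensor_power R g n\<^esub>i\<in>{..<n}. tensor R g n (as[i := br (as ! i # bs)]))"

definition twisted_bracket ::
  "('r, 'x) ring_scheme \<Rightarrow> ('r, 'a, 'y) module_scheme \<Rightarrow> nat \<Rightarrow> ('a list \<Rightarrow> 'a) \<Rightarrow> ('a \<Rightarrow> 'a) \<Rightarrow>
   'a list \<Rightarrow> 'a list \<Rightarrow> ('a list \<Rightarrow> 'r) set"
where
  "twisted_bracket R g n br \<alpha> as bs =
     (\<Oplus>\<^bsub>tensor_power R g n\<^esub>i\<in>{..<n}. tensor R g n ((map \<alpha> as)[i := br (as ! i # bs)]))"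

end

theory Submission
  imports Defs
begin

text \<open>The tensor power represents multilinear maps, so a bracket prescribed on decomposable tensors by
  an expression multilinear in both arguments extends bilinearly, and identities between multilinear
  expressions need only be checked on decomposable tensors. There the twisted bracket yields double
  sums over the slots being modified: the terms touching two different slots cancel by symmetry, and
  those touching one slot twice are the Hom-Nambu identity of \<open>g\<close>. The untwisted bracket is the
  case where the twisting map is the identity.\<close>

section \<open>Linear maps\<close>

text \<open>The symmetry of the mixed terms comes from multiplicativity. Bracketing slot
  \<open>i\<close> with \<open>b\<close> and then slot \<open>j\<close> with the
  \<open>\<alpha>\<close>-image of \<open>c\<close> leaves \<open>\<alpha>\<close> of a bracket in
  slot \<open>i\<close> and a bracket of \<open>\<alpha>\<close>-images in slot \<open>j\<close>.
  Once \<open>\<alpha>\<close> is moved inside the first bracket both slots have the same shape, and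
  exchanging \<open>b\<close> with \<open>c\<close> amounts to exchanging \<open>i\<close> with
  \<open>j\<close>. In a slot modified twice, the identity of \<open>g\<close> has
  \<open>n + 1\<close> terms: one is the same slot with \<open>b\<close> and \<open>c\<close>
  exchanged, and the other \<open>n\<close> are exactly what the outer bracket with the bracket of
  \<open>b\<close> and \<open>c\<close> contributes to that slot. The tensor power is a concrete
  quotient of a free module, so both halves of its universal property have to be derived: existence
  by factoring the free extension through the quotient, uniqueness because two linear maps agree on
  a submodule.\<close>

lemma linear_mapI:
  assumes "\<And>x. x \<in> carrier M \<Longrightarrow> f x \<in> carrier N"
    and "\<And>x y. x \<in> carrier M \<Longrightarrow> y \<in> carrier M \<Longrightarrow> f (x \<oplus>\<^bsub>M\<^esub> y) = f x \<oplus>\<^bsub>N\<^esub> f y"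
    and "\<And>c x. c \<in> carrier R \<Longrightarrow> x \<in> carrier M \<Longrightarrow> f (c \<odot>\<^bsub>M\<^esub> x) = c \<odot>\<^bsub>N\<^esub> f x"
  shows "linear_map R M N f"
  using assms by (simp add: linear_map_def)

lemma linear_map_closed: "linear_map R M N f \<Longrightarrow> x \<in> carrier M \<Longrightarrow> f x \<in> carrier N"
  by (auto simp: linear_map_def)

lemma linear_map_add:
  "linear_map R M N f \<Longrightarrow> x \<in> carrier M \<Longrightarrow> y \<in> carrier M \<Longrightarrow> f (x \<oplus>\<^bsub>M\<^esub> y) = f x \<oplus>\<^bsub>N\<^esub> f y"
  by (simp add: linear_map_def)

lemma linear_map_smult:
  "linear_map R M N f \<Longrightarrow> c \<in> carrier R \<Longrightarrow> x \<in> carrier M \<Longrightarrow> f (c \<odot>\<^bsub>M\<^esub> x) = c \<odot>\<^bsub>N\<^esub> f x"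
  by (simp add: linear_map_def)

lemma linear_map_id: "linear_map R M M (\<lambda>x. x)"
  by (simp add: linear_map_def)

lemma linear_map_comp:
  assumes "linear_map R M N f" and "linear_map R N P h"
  shows "linear_map R M P (\<lambda>x. h (f x))"
  using assms by (auto simp: linear_map_def Pi_iff)

lemma linear_map_zero:
  assumes "module R M" and "module R N" and "linear_map R M N f"
  shows "f \<zero>\<^bsub>M\<^esub> = \<zero>\<^bsub>N\<^esub>"
proof -
  interpret M: module R M by fact
  interpret N: module R N by fact
  show ?thesis
    \<comment> \<open>The zero vector is the scalar zero times itself, so homogeneity sends it to
      zero.\<close>
    using linear_map_smult[OF assms(3) M.R.zero_closed M.zero_closed]
      linear_map_closed[OF assms(3) M.zero_closed] by simp
qed

lemma linear_map_minus:
  assumes "module R M" and "module R N" and f: "linear_map R M N f"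
    and x: "x \<in> carrier M" and y: "y \<in> carrier M"
  shows "f (x \<ominus>\<^bsub>M\<^esub> y) = f x \<ominus>\<^bsub>N\<^esub> f y"
proof -
  interpret M: module R M by fact
  interpret N: module R N by fact
  note [simp] = linear_map_closed[OF f]
  have "f (x \<ominus>\<^bsub>M\<^esub> y) \<oplus>\<^bsub>N\<^esub> f y = f ((x \<ominus>\<^bsub>M\<^esub> y) \<oplus>\<^bsub>M\<^esub> y)"
    using x y by (simp add: linear_map_add[OF f])
  also have "(x \<ominus>\<^bsub>M\<^esub> y) \<oplus>\<^bsub>M\<^esub> y = x"
    using x y by (simp add: M.minus_eq M.a_assoc M.l_neg)
  finally show ?thesis
    using x y by (metis M.minus_closed N.add.inv_solve_right N.minus_eq f linear_map_closed)
qed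

lemma linear_map_finsum:
  assumes "module R M" and "module R N" and f: "linear_map R M N f"
    and "finite A" and "\<And>i. i \<in> A \<Longrightarrow> u i \<in> carrier M"
  shows "f (\<Oplus>\<^bsub>M\<^esub>i\<in>A. u i) = (\<Oplus>\<^bsub>N\<^esub>i\<in>A. f (u i))"
proof -
  interpret M: module R M by fact
  interpret N: module R N by fact
  from assms(4,5) show ?thesis
  proof (induction A)
    case empty
    show ?case using linear_map_zero[OF assms(1-3)] by simp
  next
    case (insert a A)
    then show ?case
      by (simp add: Pi_iff linear_map_add[OF f] linear_map_closed[OF f])
  qed
qed

lemma linear_map_plus:
  assumes "module R N" and f: "linear_map R M N f" and h: "linear_map R M N h"
  shows "linear_map R M N (\<lambda>x. f x \<oplus>\<^bsub>N\<^esub> h x)"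
proof -
  interpret N: module R N by fact
  show ?thesis
    using linear_map_closed[OF f] linear_map_closed[OF h]
    by (intro linear_mapI)
      (simp_all add: linear_map_add[OF f] linear_map_add[OF h] linear_map_smult[OF f]
        linear_map_smult[OF h] N.a_ac N.smult_r_distr)
qed

lemma linear_map_scale:
  assumes "module R N" and c: "c \<in> carrier R" and f: "linear_map R M N f"
  shows "linear_map R M N (\<lambda>x. c \<odot>\<^bsub>N\<^esub> f x)"
proof -
  interpret N: module R N by fact
  show ?thesis
    using linear_map_closed[OF f] c
    by (intro linear_mapI)
      (simp_all add: linear_map_add[OF f] linear_map_smult[OF f] N.smult_r_distr
        N.m_comm flip: N.smult_assoc1)
qed

lemma linear_map_sum:
  assumes "module R N" and "finite A" and "\<And>i. i \<in> A \<Longrightarrow> linear_map R M N (f i)"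
  shows "linear_map R M N (\<lambda>x. \<Oplus>\<^bsub>N\<^esub>i\<in>A. f i x)"
proof -
  interpret N: module R N by fact
  have cl: "f i x \<in> carrier N" if "i \<in> A" "x \<in> carrier M" for i x
    using that assms(3) linear_map_closed by fastforce
  show ?thesis
  proof (rule linear_mapI)
    fix x y assume xy: "x \<in> carrier M" "y \<in> carrier M"
    have "(\<Oplus>\<^bsub>N\<^esub>i\<in>A. f i (x \<oplus>\<^bsub>M\<^esub> y)) = (\<Oplus>\<^bsub>N\<^esub>i\<in>A. f i x \<oplus>\<^bsub>N\<^esub> f i y)"
      using xy cl by (intro N.finsum_cong') (auto intro: linear_map_add[OF assms(3)])
    then show "(\<Oplus>\<^bsub>N\<^esub>i\<in>A. f i (x \<oplus>\<^bsub>M\<^esub> y)) = (\<Oplus>\<^bsub>N\<^esub>i\<in>A. f i x) \<oplus>\<^bsub>N\<^esub> (\<Oplus>\<^bsub>N\<^esub>i\<in>A. f i y)"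
      using xy cl by (simp add: Pi_iff N.finsum_addf)
  next
    fix c x assume cx: "c \<in> carrier R" "x \<in> carrier M"
    have "(\<Oplus>\<^bsub>N\<^esub>i\<in>A. f i (c \<odot>\<^bsub>M\<^esub> x)) = (\<Oplus>\<^bsub>N\<^esub>i\<in>A. c \<odot>\<^bsub>N\<^esub> f i x)"
      using cx cl by (intro N.finsum_cong') (auto intro: linear_map_smult[OF assms(3)])
    then show "(\<Oplus>\<^bsub>N\<^esub>i\<in>A. f i (c \<odot>\<^bsub>M\<^esub> x)) = c \<odot>\<^bsub>N\<^esub> (\<Oplus>\<^bsub>N\<^esub>i\<in>A. f i x)"
      using cx cl assms(2) by (subst N.finsum_smult_ldistr) auto
  qed (auto simp: cl)
qed

lemma bilinear_map_left: "bilinear_map R M N P B \<Longrightarrow> y \<in> carrier N \<Longrightarrow> linear_map R M P (\<lambda>x. B x y)"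
  by (simp add: bilinear_map_def)

lemma bilinear_map_right: "bilinear_map R M N P B \<Longrightarrow> x \<in> carrier M \<Longrightarrow> linear_map R N P (B x)"
  by (simp add: bilinear_map_def)

lemma bilinear_map_closed:
  "bilinear_map R M N P B \<Longrightarrow> x \<in> carrier M \<Longrightarrow> y \<in> carrier N \<Longrightarrow> B x y \<in> carrier P"
  by (meson bilinear_map_right linear_map_closed)

text \<open>Uniqueness arguments reduce to generators in this way: a submodule containing a
  generating set is everything. With the zero map for \<open>h\<close> it also covers kernels, which
  is how maps are factored through the quotient by \<open>tensor_kernel\<close>.\<close>

lemma submodule_equalizer:
  assumes "module R M" and "module R N" and f: "linear_map R M N f" and h: "linear_map R M N h"
  shows "submodule {x \<in> carrier M. f x = h x} R M"
proof -
  interpret M: module R M by fact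
  interpret N: module R N by fact
  \<comment> \<open>Closure under negatives has to be checked, while \<open>linear_map\<close>
    speaks only of sums and scalars; a negative is treated as a difference from zero.\<close>
  have neg: "f (\<ominus>\<^bsub>M\<^esub> x) = \<ominus>\<^bsub>N\<^esub> f x" if "linear_map R M N f" "x \<in> carrier M" for f x
    using linear_map_minus[OF assms(1,2) that(1), of "\<zero>\<^bsub>M\<^esub>" x]
      linear_map_zero[OF assms(1,2) that(1)] linear_map_closed[OF that] that(2)
    by (simp add: M.minus_eq N.minus_eq)
  show ?thesis
    by (rule M.submoduleI)
      (auto simp: linear_map_zero[OF assms(1,2)] f h neg linear_map_add[OF f] linear_map_add[OF h]
        linear_map_smult[OF f] linear_map_smult[OF h])
qed


section \<open>Free modules and quotient modules\<close>

lemma free_module_simps: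
  "carrier (free_module R S) =
     {f. f \<in> S \<rightarrow> carrier R \<and> (\<forall>x. x \<notin> S \<longrightarrow> f x = \<zero>\<^bsub>R\<^esub>) \<and> finite {x. f x \<noteq> \<zero>\<^bsub>R\<^esub>}}"
  "\<zero>\<^bsub>free_module R S\<^esub> = (\<lambda>x. \<zero>\<^bsub>R\<^esub>)"
  "f \<oplus>\<^bsub>free_module R S\<^esub> h = (\<lambda>x. f x \<oplus>\<^bsub>R\<^esub> h x)"
  "c \<odot>\<^bsub>free_module R S\<^esub> f = (\<lambda>x. c \<otimes>\<^bsub>R\<^esub> f x)"
  by (simp_all add: free_module_def)

context cring
begin

lemma free_module_closed: "f \<in> carrier (free_module R S) \<Longrightarrow> f x \<in> carrier R"
  by (cases "x \<in> S") (auto simp: free_module_simps)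

text \<open>\<open>A\<close> is any finite set outside which \<open>f\<close> vanishes. Asking for
  the exact support would be awkward, since cancellation can shrink the support of a sum.\<close>

lemma free_module_carrierI:
  assumes "\<And>x. x \<in> S \<Longrightarrow> f x \<in> carrier R" and "finite A" and "A \<subseteq> S"
    and "\<And>x. x \<notin> A \<Longrightarrow> f x = \<zero>"
  shows "f \<in> carrier (free_module R S)"
proof -
  have "{x. f x \<noteq> \<zero>} \<subseteq> A" using assms(4) by auto
  then show ?thesis
    using assms finite_subset by (auto simp: free_module_simps)
qed

lemma free_module_finite: "f \<in> carrier (free_module R S) \<Longrightarrow> finite {x. f x \<noteq> \<zero>}"
  and free_module_support: "f \<in> carrier (free_module R S) \<Longrightarrow> f x \<noteq> \<zero> \<Longrightarrow> x \<in> S"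
  by (auto simp: free_module_simps)

lemma module_free_module: "module R (free_module R S)"
proof -
  have add: "f \<oplus>\<^bsub>free_module R S\<^esub> h \<in> carrier (free_module R S)"
    if "f \<in> carrier (free_module R S)" "h \<in> carrier (free_module R S)" for f h
    using that free_module_finite free_module_support unfolding free_module_simps(3)
    by (intro free_module_carrierI[where A = "{x. f x \<noteq> \<zero>} \<union> {x. h x \<noteq> \<zero>}"])
      (auto simp: free_module_closed)
  have smult: "c \<odot>\<^bsub>free_module R S\<^esub> f \<in> carrier (free_module R S)"
    if "c \<in> carrier R" "f \<in> carrier (free_module R S)" for c f
    using that free_module_finite free_module_support unfolding free_module_simps(4)
    by (intro free_module_carrierI[where A = "{x. f x \<noteq> \<zero>}"]) (auto simp: free_module_closed)
  note closed = free_module_closed[where S = S]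
  show ?thesis
  proof (rule moduleI)
    show "abelian_group (free_module R S)"
    proof (rule abelian_groupI)
      fix f assume f: "f \<in> carrier (free_module R S)"
      \<comment> \<open>The multiple by minus one serves as additive inverse; its membership is
        already known from \<open>smult\<close>.\<close>
      have "(\<ominus> \<one>) \<odot>\<^bsub>free_module R S\<^esub> f \<oplus>\<^bsub>free_module R S\<^esub> f = \<zero>\<^bsub>free_module R S\<^esub>"
        unfolding free_module_simps using closed[OF f] by (simp add: l_minus l_neg)
      with smult[of "\<ominus> \<one>" f] f
      show "\<exists>h\<in>carrier (free_module R S). h \<oplus>\<^bsub>free_module R S\<^esub> f = \<zero>\<^bsub>free_module R S\<^esub>"
        by auto
    next
      show "\<zero>\<^bsub>free_module R S\<^esub> \<in> carrier (free_module R S)" by (simp add: free_module_simps)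
    qed (simp_all only: add, simp_all add: free_module_simps(2,3) closed a_ac)
  qed (simp_all only: smult is_cring, simp_all add: free_module_simps(3,4) closed l_distr r_distr m_assoc)
qed

lemma free_gen_carrier: "s \<in> S \<Longrightarrow> free_gen R s \<in> carrier (free_module R S)"
  by (rule free_module_carrierI[where A = "{s}"]) (auto simp: free_gen_def)

text \<open>A finitely supported function is a combination of the \<open>free_gen\<close>. The
  induction runs over a finite set containing the support and leaves the function arbitrary, so that
  one value at a time can be set to zero.\<close>

lemma submodule_free_module_eq:
  assumes N: "submodule N R (free_module R S)" and gen: "\<And>s. s \<in> S \<Longrightarrow> free_gen R s \<in> N"
  shows "N = carrier (free_module R S)"
proof
  interpret F: module R "free_module R S" by (rule module_free_module)
  note E = F.submoduleE[OF N]
  show "N \<subseteq> carrier (free_module R S)" by (rule E(1))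
  have zero: "\<zero>\<^bsub>free_module R S\<^esub> \<in> N"
    using E(2,4) E(1) zero_closed by (metis F.smult_l_null equals0I subsetD)
  have "f \<in> N" if "finite A" "A \<subseteq> S" "\<And>s. s \<in> A \<Longrightarrow> f s \<in> carrier R" "\<And>s. s \<notin> A \<Longrightarrow> f s = \<zero>" for A f
    using that
  proof (induction A arbitrary: f)
    case empty
    then have "f = \<zero>\<^bsub>free_module R S\<^esub>" by (auto simp: free_module_simps)
    with zero show ?case by simp
  next
    case (insert a A)
    have "f(a := \<zero>) \<in> N" using insert by auto
    moreover have "f a \<odot>\<^bsub>free_module R S\<^esub> free_gen R a \<in> N" using insert gen E(4) by simp
    moreover have "f = f(a := \<zero>) \<oplus>\<^bsub>free_module R S\<^esub> f a \<odot>\<^bsub>free_module R S\<^esub> free_gen R a"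
    proof
      fix x
      have "f x \<in> carrier R" using insert.prems(2,3) by (cases "x \<in> insert a A") auto
      then show "f x = (f(a := \<zero>) \<oplus>\<^bsub>free_module R S\<^esub> f a \<odot>\<^bsub>free_module R S\<^esub> free_gen R a) x"
        using insert.prems(2) by (auto simp: free_module_simps free_gen_def)
    qed
    ultimately show ?case using E(5) by metis
  qed
  note * = this
  show "carrier (free_module R S) \<subseteq> N"
  proof
    fix f assume f: "f \<in> carrier (free_module R S)"
    show "f \<in> N"
      by (rule *[OF free_module_finite[OF f]])
        (auto intro: free_module_support[OF f] free_module_closed[OF f])
  qed
qed

lemma free_module_lift:
  assumes "module R M" and h: "h \<in> S \<rightarrow> carrier M"
  obtains f where "linear_map R (free_module R S) M f" and "\<And>s. s \<in> S \<Longrightarrow> f (free_gen R s) = h s"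
proof -
  interpret M: module R M by fact
  define f where "f u = (\<Oplus>\<^bsub>M\<^esub>s\<in>{s. u s \<noteq> \<zero>}. u s \<odot>\<^bsub>M\<^esub> h s)" for u
  \<comment> \<open>The sum defining \<open>f u\<close> runs over the support of \<open>u\<close>,
    which varies with \<open>u\<close>. Padding with zero terms to a common finite index set makes
    the sums for different functions comparable, even when supports shrink by cancellation.\<close>
  have f_eq: "f u = (\<Oplus>\<^bsub>M\<^esub>s\<in>A. u s \<odot>\<^bsub>M\<^esub> h s)"
    if "finite A" "A \<subseteq> S" "{s. u s \<noteq> \<zero>} \<subseteq> A" "u \<in> carrier (free_module R S)" for u A
    unfolding f_def using that h free_module_closed[OF that(4)]
    by (intro M.add.finprod_mono_neutral_cong_left) (auto simp: subset_iff Pi_iff)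
  show thesis
  proof (rule that[of f], rule linear_mapI)
    fix u assume "u \<in> carrier (free_module R S)"
    then show "f u \<in> carrier M"
      unfolding f_def using h free_module_closed free_module_support by (intro M.finsum_closed) fastforce
  next
    interpret F: module R "free_module R S" by (rule module_free_module)
    fix u v assume uv: "u \<in> carrier (free_module R S)" "v \<in> carrier (free_module R S)"
    define A where "A = {s. u s \<noteq> \<zero>} \<union> {s. v s \<noteq> \<zero>}"
    have A: "finite A" "A \<subseteq> S"
      using uv free_module_finite free_module_support by (auto simp: A_def)
    have cl: "u s \<odot>\<^bsub>M\<^esub> h s \<in> carrier M" "v s \<odot>\<^bsub>M\<^esub> h s \<in> carrier M" if "s \<in> A" for s
      using that A(2) uv[THEN free_module_closed] h by (auto simp: Pi_iff subset_iff)
    have "f (u \<oplus>\<^bsub>free_module R S\<^esub> v) = (\<Oplus>\<^bsub>M\<^esub>s\<in>A. (u \<oplus>\<^bsub>free_module R S\<^esub> v) s \<odot>\<^bsub>M\<^esub> h s)"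
      using A uv F.a_closed by (intro f_eq) (auto simp: A_def free_module_simps(3))
    also have "\<dots> = (\<Oplus>\<^bsub>M\<^esub>s\<in>A. u s \<odot>\<^bsub>M\<^esub> h s \<oplus>\<^bsub>M\<^esub> v s \<odot>\<^bsub>M\<^esub> h s)"
      using cl A(2) uv[THEN free_module_closed] h
      by (intro M.finsum_cong') (auto simp: free_module_simps(3) intro!: M.smult_l_distr)
    also have "\<dots> = f u \<oplus>\<^bsub>M\<^esub> f v"
      using cl A uv f_eq[of A u] f_eq[of A v] by (simp add: M.finsum_addf Pi_iff A_def)
    finally show "f (u \<oplus>\<^bsub>free_module R S\<^esub> v) = f u \<oplus>\<^bsub>M\<^esub> f v" .
  next
    interpret F: module R "free_module R S" by (rule module_free_module)
    fix c u assume cu: "c \<in> carrier R" "u \<in> carrier (free_module R S)"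
    define A where "A = {s. u s \<noteq> \<zero>}"
    have A: "finite A" "A \<subseteq> S"
      using cu free_module_finite free_module_support by (auto simp: A_def)
    have cl: "u s \<odot>\<^bsub>M\<^esub> h s \<in> carrier M" if "s \<in> A" for s
      using that A(2) cu(1) cu(2)[THEN free_module_closed] h by (auto simp: Pi_iff subset_iff)
    have "f (c \<odot>\<^bsub>free_module R S\<^esub> u) = (\<Oplus>\<^bsub>M\<^esub>s\<in>A. (c \<odot>\<^bsub>free_module R S\<^esub> u) s \<odot>\<^bsub>M\<^esub> h s)"
      using A cu F.smult_closed by (intro f_eq) (auto simp: A_def free_module_simps(4))
    also have "\<dots> = (\<Oplus>\<^bsub>M\<^esub>s\<in>A. c \<odot>\<^bsub>M\<^esub> (u s \<odot>\<^bsub>M\<^esub> h s))"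
      using cl A(2) cu(1) cu(2)[THEN free_module_closed] h
      by (intro M.finsum_cong') (auto simp: free_module_simps(4) intro!: M.smult_assoc1)
    also have "\<dots> = c \<odot>\<^bsub>M\<^esub> f u"
      using cl A cu by (simp add: M.finsum_smult_ldistr Pi_iff f_def flip: A_def)
    finally show "f (c \<odot>\<^bsub>free_module R S\<^esub> u) = c \<odot>\<^bsub>M\<^esub> f u" .
  next
    fix s assume s: "s \<in> S"
    then have "f (free_gen R s) = (\<Oplus>\<^bsub>M\<^esub>t\<in>{s}. free_gen R s t \<odot>\<^bsub>M\<^esub> h t)"
      by (intro f_eq free_gen_carrier) (auto simp: free_gen_def)
    also have "\<dots> = h s"
      using s h by (auto simp: free_gen_def Pi_iff)
    finally show "f (free_gen R s) = h s" .
  qed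
qed

end

section \<open>Generated submodules and quotient modules\<close>

context module
begin

text \<open>Because \<open>S\<close> lies in the carrier, the carrier is itself one of the
  submodules being intersected, which keeps the intersection inside it.\<close>

lemma submodule_generated_submodule:
  assumes "S \<subseteq> carrier M"
  shows "submodule (submodule_generated R M S) R M"
proof (rule submoduleI)
  show "submodule_generated R M S \<subseteq> carrier M"
    using assms carrier_is_submodule by (auto simp: submodule_generated_def)
next
  have "\<zero>\<^bsub>M\<^esub> \<in> N" if "submodule N R M" for N
    using subgroup.one_closed[OF submodule.axioms(1)[OF that]] by simp
  then show "\<zero>\<^bsub>M\<^esub> \<in> submodule_generated R M S" by (simp add: submodule_generated_def)
qed (simp_all add: submodule_generated_def submoduleE)

lemma submodule_generated_subset: "S \<subseteq> submodule_generated R M S"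
  by (auto simp: submodule_generated_def)

lemma submodule_generated_least:
  "submodule N R M \<Longrightarrow> S \<subseteq> N \<Longrightarrow> submodule_generated R M S \<subseteq> N"
  by (auto simp: submodule_generated_def)

lemma abelian_subgroup_submodule: "submodule N R M \<Longrightarrow> abelian_subgroup N M"
  by (intro abelian_subgroupI3 additive_subgroupI submodule.axioms(1) M.abelian_group_axioms)

text \<open>The definition takes a union of cosets over all representatives. Two representatives
  differ by an element of \<open>N\<close>, whose multiple by \<open>c\<close> stays in
  \<open>N\<close>; so these cosets all coincide and the nonempty union is that one coset.\<close>

lemma quotient_module_smult:
  assumes N: "submodule N R M" and c: "c \<in> carrier R" and x: "x \<in> carrier M"
  shows "c \<odot>\<^bsub>quotient_module M N\<^esub> (N +>\<^bsub>M\<^esub> x) = N +>\<^bsub>M\<^esub> (c \<odot>\<^bsub>M\<^esub> x)"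
proof -
  interpret N: abelian_subgroup N M by (rule abelian_subgroup_submodule[OF N])
  have "N +>\<^bsub>M\<^esub> (c \<odot>\<^bsub>M\<^esub> y) = N +>\<^bsub>M\<^esub> (c \<odot>\<^bsub>M\<^esub> x)" if y: "y \<in> N +>\<^bsub>M\<^esub> x" for y
  proof -
    obtain k where k: "k \<in> N" "y = k \<oplus>\<^bsub>M\<^esub> x" using y by (auto simp: a_r_coset_def')
    then have "c \<odot>\<^bsub>M\<^esub> y = c \<odot>\<^bsub>M\<^esub> k \<oplus>\<^bsub>M\<^esub> c \<odot>\<^bsub>M\<^esub> x"
      using c x N.a_subset by (auto simp: smult_r_distr)
    moreover have "c \<odot>\<^bsub>M\<^esub> k \<in> N" using submoduleE(4)[OF N] c k(1) .
    ultimately have "c \<odot>\<^bsub>M\<^esub> y \<in> N +>\<^bsub>M\<^esub> (c \<odot>\<^bsub>M\<^esub> x)" by (auto simp: a_r_coset_def')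
    then show ?thesis
      using c x N.a_repr_independence' by (metis smult_closed)
  qed
  moreover have "N +>\<^bsub>M\<^esub> x \<noteq> {}" using x N.a_rcos_self by blast
  ultimately have "(\<Union>y\<in>N +>\<^bsub>M\<^esub> x. N +>\<^bsub>M\<^esub> (c \<odot>\<^bsub>M\<^esub> y)) = N +>\<^bsub>M\<^esub> (c \<odot>\<^bsub>M\<^esub> x)"
    by simp
  then show ?thesis by (simp add: quotient_module_def)
qed

lemma quotient_module_add:
  assumes N: "submodule N R M" and "x \<in> carrier M" and "y \<in> carrier M"
  shows "(N +>\<^bsub>M\<^esub> x) \<oplus>\<^bsub>quotient_module M N\<^esub> (N +>\<^bsub>M\<^esub> y) = N +>\<^bsub>M\<^esub> (x \<oplus>\<^bsub>M\<^esub> y)"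
  using assms abelian_subgroup.a_rcos_sum[OF abelian_subgroup_submodule[OF N]]
  by (simp add: quotient_module_def)

lemma quotient_module_carrier:
  "carrier (quotient_module M N) = (\<lambda>x. N +>\<^bsub>M\<^esub> x) ` carrier M"
  by (auto simp: quotient_module_def A_RCOSETS_def')

lemma module_quotient_module:
  assumes N: "submodule N R M"
  shows "module R (quotient_module M N)"
proof (rule moduleI)
  interpret N: abelian_subgroup N M by (rule abelian_subgroup_submodule[OF N])
  have zero: "\<zero>\<^bsub>quotient_module M N\<^esub> = N +>\<^bsub>M\<^esub> \<zero>\<^bsub>M\<^esub>"
    using N.a_subset by (simp add: quotient_module_def)
  show "abelian_group (quotient_module M N)"
  proof (rule abelian_groupI)
    fix X assume "X \<in> carrier (quotient_module M N)"
    then obtain x where x: "x \<in> carrier M" "X = N +>\<^bsub>M\<^esub> x" by (auto simp: quotient_module_carrier)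
    then show "\<exists>Y\<in>carrier (quotient_module M N). Y \<oplus>\<^bsub>quotient_module M N\<^esub> X = \<zero>\<^bsub>quotient_module M N\<^esub>"
      by (auto simp: quotient_module_carrier zero quotient_module_add[OF N] M.l_neg
          intro!: bexI[of _ "\<ominus>\<^bsub>M\<^esub> x"])
  qed (auto simp: quotient_module_carrier zero quotient_module_add[OF N] M.a_ac)
  show "cring R" by (rule R.is_cring)
qed (use N in \<open>auto simp: quotient_module_carrier quotient_module_smult quotient_module_add
    smult_l_distr smult_r_distr smult_assoc1\<close>)

lemma linear_map_quotient:
  "submodule N R M \<Longrightarrow> linear_map R M (quotient_module M N) (\<lambda>x. N +>\<^bsub>M\<^esub> x)"
  by (rule linear_mapI)
    (simp_all add: quotient_module_carrier quotient_module_smult quotient_module_add)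

end

text \<open>Elements of one coset differ by an element of \<open>N\<close>, which \<open>f\<close>
  kills, so the image of each coset under \<open>f\<close> is a singleton. The induced map returns
  its only element, which avoids choosing representatives.\<close>

lemma quotient_module_lift:
  assumes M: "module R M" and N: "submodule N R M" and P: "module R P" and f: "linear_map R M P f"
    and ker: "\<And>x. x \<in> N \<Longrightarrow> f x = \<zero>\<^bsub>P\<^esub>"
  obtains h where "linear_map R (quotient_module M N) P h"
    and "\<And>x. x \<in> carrier M \<Longrightarrow> h (N +>\<^bsub>M\<^esub> x) = f x"
proof -
  interpret M: module R M by fact
  interpret N: abelian_subgroup N M by (rule M.abelian_subgroup_submodule[OF N])
  interpret P: module R P by fact
  define h where "h X = (THE y. y \<in> f ` X)" for X
  have h: "h (N +>\<^bsub>M\<^esub> x) = f x" if x: "x \<in> carrier M" for x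
  proof -
    have "f y = f x" if y: "y \<in> N +>\<^bsub>M\<^esub> x" for y
    proof -
      obtain k where k: "k \<in> N" "y = k \<oplus>\<^bsub>M\<^esub> x" using y by (auto simp: a_r_coset_def')
      then show ?thesis
        using x N.a_subset linear_map_closed[OF f x] by (auto simp: linear_map_add[OF f] ker)
    qed
    moreover have "x \<in> N +>\<^bsub>M\<^esub> x" using x by (rule N.a_rcos_self)
    ultimately have "f ` (N +>\<^bsub>M\<^esub> x) = {f x}" by blast
    then show ?thesis by (simp add: h_def)
  qed
  moreover have "linear_map R (quotient_module M N) P h"
    by (rule linear_mapI)
      (auto simp: M.quotient_module_carrier M.quotient_module_smult[OF N] M.quotient_module_add[OF N] h
        linear_map_closed[OF f] linear_map_add[OF f] linear_map_smult[OF f])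
  ultimately show thesis using that by blast
qed

section \<open>Tensor powers\<close>

lemma tuples_update: "xs \<in> tuples M n \<Longrightarrow> x \<in> carrier M \<Longrightarrow> xs[i := x] \<in> tuples M n"
  using set_update_subset_insert[of xs i x] by (auto simp: tuples_def)

lemma tuples_nth: "xs \<in> tuples M n \<Longrightarrow> i < n \<Longrightarrow> xs ! i \<in> carrier M"
  by (auto simp: tuples_def)

lemma tuples_length: "xs \<in> tuples M n \<Longrightarrow> length xs = n"
  by (simp add: tuples_def)

lemma tuples_Cons: "x # xs \<in> tuples M (Suc n) \<longleftrightarrow> x \<in> carrier M \<and> xs \<in> tuples M n"
  by (auto simp: tuples_def)

lemma tuples_map: "linear_map R M N f \<Longrightarrow> xs \<in> tuples M n \<Longrightarrow> map f xs \<in> tuples N n"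
  by (auto simp: tuples_def linear_map_def)

lemma multilinear_map_closed: "multilinear_map R M n N f \<Longrightarrow> xs \<in> tuples M n \<Longrightarrow> f xs \<in> carrier N"
  by (auto simp: multilinear_map_def)

lemma multilinear_map_linear:
  "multilinear_map R M n N f \<Longrightarrow> xs \<in> tuples M n \<Longrightarrow> i < n \<Longrightarrow> linear_map R M N (\<lambda>x. f (xs[i := x]))"
  by (auto simp: multilinear_map_def)

lemma multilinear_mapI:
  assumes "\<And>xs. xs \<in> tuples M n \<Longrightarrow> f xs \<in> carrier N"
    and "\<And>xs i. xs \<in> tuples M n \<Longrightarrow> i < n \<Longrightarrow> linear_map R M N (\<lambda>x. f (xs[i := x]))"
  shows "multilinear_map R M n N f"
  using assms by (auto simp: multilinear_map_def)

section \<open>The universal property of the tensor power\<close>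

context module
begin

lemma module_tensor_free: "module R (tensor_free R M n)"
  unfolding tensor_free_def by (rule R.module_free_module)

lemma free_gen_tensor_free: "xs \<in> tuples M n \<Longrightarrow> free_gen R xs \<in> carrier (tensor_free R M n)"
  unfolding tensor_free_def by (rule R.free_gen_carrier)

lemma tensor_relators_subset: "tensor_relators R M n \<subseteq> carrier (tensor_free R M n)"
proof -
  interpret F: module R "tensor_free R M n" by (rule module_tensor_free)
  show ?thesis
    by (auto simp: tensor_relators_def intro!: F.M.minus_closed F.M.a_closed F.smult_closed
        free_gen_tensor_free tuples_update)
qed

lemma submodule_tensor_kernel: "submodule (tensor_kernel R M n) R (tensor_free R M n)"
  unfolding tensor_kernel_def
  by (rule module.submodule_generated_submodule[OF module_tensor_free tensor_relators_subset])

lemma module_tensor_power: "module R (tensor_power R M n)"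
  unfolding tensor_power_def
  by (rule module.module_quotient_module[OF module_tensor_free submodule_tensor_kernel])

text \<open>Pulled back to the free module along the projection, the two maps agree on a submodule
  containing every generator, hence everywhere; and the projection is onto. Identities on the whole
  tensor power are obtained from this principle, one variable at a time.\<close>

lemma tensor_power_eqI:
  assumes "module R P" and f: "linear_map R (tensor_power R M n) P f"
    and h: "linear_map R (tensor_power R M n) P h"
    and eq: "\<And>xs. xs \<in> tuples M n \<Longrightarrow> f (tensor R M n xs) = h (tensor R M n xs)"
    and x: "x \<in> carrier (tensor_power R M n)"
  shows "f x = h x"
proof -
  let ?F = "tensor_free R M n" and ?K = "tensor_kernel R M n"
  have proj: "linear_map R ?F (tensor_power R M n) (\<lambda>x. ?K +>\<^bsub>?F\<^esub> x)"
    unfolding tensor_power_def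
    by (rule module.linear_map_quotient[OF module_tensor_free submodule_tensor_kernel])
  have "{u \<in> carrier ?F. f (?K +>\<^bsub>?F\<^esub> u) = h (?K +>\<^bsub>?F\<^esub> u)} = carrier ?F"
    unfolding tensor_free_def
  proof (rule R.submodule_free_module_eq, fold tensor_free_def)
    show "submodule {u \<in> carrier ?F. f (?K +>\<^bsub>?F\<^esub> u) = h (?K +>\<^bsub>?F\<^esub> u)} R ?F"
      by (rule submodule_equalizer[OF module_tensor_free assms(1)
            linear_map_comp[OF proj f] linear_map_comp[OF proj h]])
  qed (use eq in \<open>auto simp: free_gen_tensor_free tensor_def\<close>)
  moreover obtain u where "u \<in> carrier ?F" "x = ?K +>\<^bsub>?F\<^esub> u"
    using x unfolding tensor_power_def
      module.quotient_module_carrier[OF module_tensor_free] by blast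
  ultimately show ?thesis by blast
qed

text \<open>Each relator is the difference of the two sides of a multilinearity relation between
  generators. It lies in the kernel, so both sides have the same coset, and linearity of the
  projection does the rest.\<close>

lemma multilinear_map_tensor: "multilinear_map R M n (tensor_power R M n) (tensor R M n)"
proof -
  let ?F = "tensor_free R M n" and ?K = "tensor_kernel R M n" and ?T = "tensor_power R M n"
  interpret F: module R ?F by (rule module_tensor_free)
  interpret T: module R ?T by (rule module_tensor_power)
  interpret K: abelian_subgroup ?K ?F
    by (rule F.abelian_subgroup_submodule[OF submodule_tensor_kernel])
  have proj: "linear_map R ?F ?T (\<lambda>x. ?K +>\<^bsub>?F\<^esub> x)"
    unfolding tensor_power_def by (rule F.linear_map_quotient[OF submodule_tensor_kernel])
  have eq: "?K +>\<^bsub>?F\<^esub> u = ?K +>\<^bsub>?F\<^esub> v"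
    if "u \<ominus>\<^bsub>?F\<^esub> v \<in> tensor_relators R M n" "u \<in> carrier ?F" "v \<in> carrier ?F" for u v
    using that F.submodule_generated_subset[of "tensor_relators R M n"]
      K.a_rcos_module[of v u] K.a_repr_independence'[of u v]
    by (auto simp: tensor_kernel_def F.M.minus_eq)
  have cl: "tensor R M n xs \<in> carrier ?T" if "xs \<in> tuples M n" for xs
    using linear_map_closed[OF proj free_gen_tensor_free[OF that]] by (simp add: tensor_def)
  show ?thesis
  proof (rule multilinear_mapI, rule cl, assumption)
    fix xs i assume xs: "xs \<in> tuples M n" and i: "i < n"
    have gen: "free_gen R (xs[i := x]) \<in> carrier ?F" if "x \<in> carrier M" for x
      using that xs by (intro free_gen_tensor_free tuples_update)
    show "linear_map R M ?T (\<lambda>x. tensor R M n (xs[i := x]))"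
    proof (rule linear_mapI)
      fix x y assume xy: "x \<in> carrier M" "y \<in> carrier M"
      have "tensor R M n (xs[i := x \<oplus>\<^bsub>M\<^esub> y]) =
          ?K +>\<^bsub>?F\<^esub> (free_gen R (xs[i := x]) \<oplus>\<^bsub>?F\<^esub> free_gen R (xs[i := y]))"
        unfolding tensor_def using xy xs i gen
        by (intro eq) (auto simp: tensor_relators_def)
      then show "tensor R M n (xs[i := x \<oplus>\<^bsub>M\<^esub> y]) =
          tensor R M n (xs[i := x]) \<oplus>\<^bsub>?T\<^esub> tensor R M n (xs[i := y])"
        using xy gen by (simp add: linear_map_add[OF proj] tensor_def)
    next
      fix c x assume cx: "c \<in> carrier R" "x \<in> carrier M"
      have "tensor R M n (xs[i := c \<odot>\<^bsub>M\<^esub> x]) = ?K +>\<^bsub>?F\<^esub> (c \<odot>\<^bsub>?F\<^esub> free_gen R (xs[i := x]))"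
        unfolding tensor_def using cx xs i gen
        by (intro eq) (auto simp: tensor_relators_def)
      then show "tensor R M n (xs[i := c \<odot>\<^bsub>M\<^esub> x]) = c \<odot>\<^bsub>?T\<^esub> tensor R M n (xs[i := x])"
        using cx gen by (simp add: linear_map_smult[OF proj] tensor_def)
    qed (use xs in \<open>auto intro: cl tuples_update\<close>)
  qed
qed

lemma tensor_closed: "xs \<in> tuples M n \<Longrightarrow> tensor R M n xs \<in> carrier (tensor_power R M n)"
  by (rule multilinear_map_closed[OF multilinear_map_tensor])

text \<open>The free extension \<open>u\<close> of \<open>f\<close> kills the relators because
  \<open>f\<close> is multilinear. Its kernel is a submodule, so it contains all of
  \<open>tensor_kernel\<close> by minimality, and \<open>u\<close> factors through the
  quotient.\<close>

lemma tensor_power_lift: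
  assumes P: "module R P" and f: "multilinear_map R M n P f"
  obtains h where "linear_map R (tensor_power R M n) P h"
    and "\<And>xs. xs \<in> tuples M n \<Longrightarrow> h (tensor R M n xs) = f xs"
proof -
  let ?F = "tensor_free R M n" and ?K = "tensor_kernel R M n"
  interpret F: module R ?F by (rule module_tensor_free)
  interpret P: module R P by fact
  obtain u where u: "linear_map R ?F P u" and gen: "\<And>xs. xs \<in> tuples M n \<Longrightarrow> u (free_gen R xs) = f xs"
    using R.free_module_lift[OF P, of f "tuples M n"] multilinear_map_closed[OF f]
    unfolding tensor_free_def by blast
  have "linear_map R ?F P (\<lambda>x. \<zero>\<^bsub>P\<^esub>)" by (rule linear_mapI) auto
  note ker = submodule_equalizer[OF module_tensor_free P u this]
  have "tensor_relators R M n \<subseteq> {x \<in> carrier ?F. u x = \<zero>\<^bsub>P\<^esub>}"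
  proof
    fix r assume r: "r \<in> tensor_relators R M n"
    then have "r \<in> carrier ?F" using tensor_relators_subset by blast
    moreover have "u r = \<zero>\<^bsub>P\<^esub>"
      using r unfolding tensor_relators_def
    proof (elim UnE CollectE exE conjE)
      fix xs i x y
      assume r: "r = free_gen R (xs[i := x \<oplus>\<^bsub>M\<^esub> y]) \<ominus>\<^bsub>?F\<^esub>
          (free_gen R (xs[i := x]) \<oplus>\<^bsub>?F\<^esub> free_gen R (xs[i := y]))"
        and *: "xs \<in> tuples M n" "i < n" "x \<in> carrier M" "y \<in> carrier M"
      note lin = multilinear_map_linear[OF f *(1,2)]
      show ?thesis
        unfolding r using * linear_map_closed[OF lin]
        by (simp add: linear_map_minus[OF module_tensor_free P u] linear_map_add[OF u]
            free_gen_tensor_free tuples_update gen linear_map_add[OF lin] P.minus_eq P.r_neg)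
    next
      fix xs i c x
      assume r: "r = free_gen R (xs[i := c \<odot>\<^bsub>M\<^esub> x]) \<ominus>\<^bsub>?F\<^esub> (c \<odot>\<^bsub>?F\<^esub> free_gen R (xs[i := x]))"
        and *: "xs \<in> tuples M n" "i < n" "c \<in> carrier R" "x \<in> carrier M"
      note lin = multilinear_map_linear[OF f *(1,2)]
      show ?thesis
        unfolding r using * linear_map_closed[OF lin]
        by (simp add: linear_map_minus[OF module_tensor_free P u] linear_map_smult[OF u]
            free_gen_tensor_free tuples_update gen linear_map_smult[OF lin] P.minus_eq P.r_neg)
    qed
    ultimately show "r \<in> {x \<in> carrier ?F. u x = \<zero>\<^bsub>P\<^esub>}" by simp
  qed
  then have "?K \<subseteq> {x \<in> carrier ?F. u x = \<zero>\<^bsub>P\<^esub>}"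
    unfolding tensor_kernel_def by (rule F.submodule_generated_least[OF ker])
  then obtain h where "linear_map R (tensor_power R M n) P h"
    and "\<And>x. x \<in> carrier ?F \<Longrightarrow> h (?K +>\<^bsub>?F\<^esub> x) = u x"
    using quotient_module_lift[OF module_tensor_free submodule_tensor_kernel P u] unfolding tensor_power_def by blast
  then show thesis
    using that gen free_gen_tensor_free by (simp add: tensor_def)
qed

text \<open>The lift in the first factor is again multilinear in the second, because both sides of each
  multilinearity relation are linear in the first factor and agree on decomposable tensors.\<close>

lemma tensor_power_bilinear_lift:
  assumes P: "module R P"
    and left: "\<And>bs. bs \<in> tuples M m \<Longrightarrow> multilinear_map R M n P (\<lambda>as. F as bs)"
    and right: "\<And>as. as \<in> tuples M n \<Longrightarrow> multilinear_map R M m P (F as)"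
  shows "\<exists>B. bilinear_map R (tensor_power R M n) (tensor_power R M m) P B \<and>
    (\<forall>as\<in>tuples M n. \<forall>bs\<in>tuples M m. B (tensor R M n as) (tensor R M m bs) = F as bs)"
proof -
  let ?T = "tensor_power R M n" and ?U = "tensor_power R M m"
  interpret T: module R ?T by (rule module_tensor_power)
  interpret P: module R P by fact
  have "\<exists>h. linear_map R ?T P h \<and> (\<forall>as\<in>tuples M n. h (tensor R M n as) = F as bs)"
    if bs: "bs \<in> tuples M m" for bs
    by (rule tensor_power_lift[OF P left[OF bs]]) blast
  then obtain L where L: "\<And>bs. bs \<in> tuples M m \<Longrightarrow> linear_map R ?T P (L bs)"
    and LF: "\<And>as bs. bs \<in> tuples M m \<Longrightarrow> as \<in> tuples M n \<Longrightarrow> L bs (tensor R M n as) = F as bs"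
    by metis
  have "multilinear_map R M m P (\<lambda>bs. L bs t)" if t: "t \<in> carrier ?T" for t
  proof (rule multilinear_mapI)
    fix bs i assume bs: "bs \<in> tuples M m" and i: "i < m"
    note Lx = L[OF tuples_update[OF bs]]
    show "linear_map R M P (\<lambda>x. L (bs[i := x]) t)"
    proof (rule linear_mapI)
      fix x y assume xy: "x \<in> carrier M" "y \<in> carrier M"
      show "L (bs[i := x \<oplus>\<^bsub>M\<^esub> y]) t = L (bs[i := x]) t \<oplus>\<^bsub>P\<^esub> L (bs[i := y]) t"
        by (rule tensor_power_eqI[OF P Lx linear_map_plus[OF P Lx Lx]])
          (use xy bs i t in \<open>auto simp: LF tuples_update linear_map_add[OF multilinear_map_linear[OF right]]\<close>)
    next
      fix c x assume cx: "c \<in> carrier R" "x \<in> carrier M"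
      show "L (bs[i := c \<odot>\<^bsub>M\<^esub> x]) t = c \<odot>\<^bsub>P\<^esub> L (bs[i := x]) t"
        by (rule tensor_power_eqI[OF P Lx linear_map_scale[OF P _ Lx]])
          (use cx bs i t in \<open>auto simp: LF tuples_update linear_map_smult[OF multilinear_map_linear[OF right]]\<close>)
    qed (use t linear_map_closed[OF Lx] in auto)
  qed (use t linear_map_closed[OF L] in auto)
  then have "\<exists>h. linear_map R ?U P h \<and> (\<forall>bs\<in>tuples M m. h (tensor R M m bs) = L bs t)"
    if "t \<in> carrier ?T" for t
    using that by (metis tensor_power_lift[OF P])
  then obtain B where B: "\<And>t. t \<in> carrier ?T \<Longrightarrow> linear_map R ?U P (B t)"
    and BL: "\<And>t bs. t \<in> carrier ?T \<Longrightarrow> bs \<in> tuples M m \<Longrightarrow> B t (tensor R M m bs) = L bs t"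
    by metis
  \<comment> \<open>The maps \<open>B t\<close> were chosen separately for each \<open>t\<close>, so
    linearity in \<open>t\<close> needs an argument: both sides are linear in \<open>y\<close>, and
    for decomposable \<open>y\<close> the claim is the linearity of \<open>L bs\<close>.\<close>
  have "linear_map R ?T P (\<lambda>t. B t y)" if y: "y \<in> carrier ?U" for y
  proof (rule linear_mapI)
    fix s t assume st: "s \<in> carrier ?T" "t \<in> carrier ?T"
    show "B (s \<oplus>\<^bsub>?T\<^esub> t) y = B s y \<oplus>\<^bsub>P\<^esub> B t y"
      by (rule tensor_power_eqI[OF P B linear_map_plus[OF P B B]])
          (use st y in \<open>auto simp: BL linear_map_add[OF L]\<close>)
  next
    fix c t assume ct: "c \<in> carrier R" "t \<in> carrier ?T"
    show "B (c \<odot>\<^bsub>?T\<^esub> t) y = c \<odot>\<^bsub>P\<^esub> B t y"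
      by (rule tensor_power_eqI[OF P B linear_map_scale[OF P _ B]])
          (use ct y in \<open>auto simp: BL linear_map_smult[OF L]\<close>)
  qed (use y linear_map_closed[OF B] in auto)
  then show ?thesis
    using B BL LF tensor_closed by (auto simp: bilinear_map_def intro!: exI[of _ B])
qed

end

section \<open>The bracket on the tensor power\<close>

lemma (in abelian_monoid) finsum_swap:
  assumes "finite A" and "finite B" and "\<And>i j. i \<in> A \<Longrightarrow> j \<in> B \<Longrightarrow> f i j \<in> carrier G"
  shows "(\<Oplus>i\<in>A. \<Oplus>j\<in>B. f i j) = (\<Oplus>j\<in>B. \<Oplus>i\<in>A. f i j)"
  using assms(1,3)
proof (induction A)
  case empty
  then show ?case by (simp add: finsum_zero)
next
  case (insert a A)
  then show ?case by (simp add: Pi_iff finsum_addf cong: finsum_cong)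
qed

text \<open>In a bracket applied twice the diagonal collects the terms that modify one slot twice.
  The rest stays a sum over the full square with zeros on the diagonal, so that the order of
  summation can be exchanged without dependent ranges.\<close>

lemma (in abelian_monoid) finsum_split_diagonal:
  assumes "finite A" and "\<And>i. i \<in> A \<Longrightarrow> d i \<in> carrier G"
    and "\<And>i j. i \<in> A \<Longrightarrow> j \<in> A \<Longrightarrow> f i j \<in> carrier G"
  shows "(\<Oplus>i\<in>A. \<Oplus>j\<in>A. if i = j then d i else f i j) =
    (\<Oplus>i\<in>A. d i) \<oplus> (\<Oplus>i\<in>A. \<Oplus>j\<in>A. if i = j then \<zero> else f i j)"
proof -
  have "(\<Oplus>j\<in>A. if i = j then d i else f i j) = d i \<oplus> (\<Oplus>j\<in>A. if i = j then \<zero> else f i j)"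
    if i: "i \<in> A" for i
  proof -
    have "(\<Oplus>j\<in>A. if i = j then d i else f i j) =
        (\<Oplus>j\<in>A. (if i = j then d j else \<zero>) \<oplus> (if i = j then \<zero> else f i j))"
      using assms i by (intro finsum_cong') auto
    also have "\<dots> = (\<Oplus>j\<in>A. if i = j then d j else \<zero>) \<oplus> (\<Oplus>j\<in>A. if i = j then \<zero> else f i j)"
      using assms i by (intro finsum_addf) auto
    also have "(\<Oplus>j\<in>A. if i = j then d j else \<zero>) = d i"
      using assms i by (intro finsum_singleton) auto
    finally show ?thesis .
  qed
  then have "(\<Oplus>i\<in>A. \<Oplus>j\<in>A. if i = j then d i else f i j) =
      (\<Oplus>i\<in>A. d i \<oplus> (\<Oplus>j\<in>A. if i = j then \<zero> else f i j))"
    using assms by (intro finsum_cong') (auto intro!: finsum_closed a_closed)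
  also have "\<dots> = (\<Oplus>i\<in>A. d i) \<oplus> (\<Oplus>i\<in>A. \<Oplus>j\<in>A. if i = j then \<zero> else f i j)"
    using assms by (intro finsum_addf) (auto intro!: finsum_closed)
  finally show ?thesis .
qed

section \<open>Multilinearity and extension of the twisted bracket\<close>

context module
begin

lemma multilinear_map_Cons_closed:
  assumes "multilinear_map R M (Suc n) M br" and "x \<in> carrier M" and "bs \<in> tuples M n"
  shows "br (x # bs) \<in> carrier M"
  using assms by (intro multilinear_map_closed[OF assms(1)]) (simp add: tuples_Cons)

text \<open>The variable in slot \<open>j\<close> enters each summand exactly once. In summand
  \<open>j\<close> it is the first argument of \<open>br\<close>, since the update overwrites its
  \<open>\<alpha>\<close>-image; in every other summand it occurs only through that image. Each
  summand is thus a composite of linear maps.\<close>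

lemma multilinear_map_twisted_bracket_left:
  assumes br: "multilinear_map R M (Suc n) M br" and \<alpha>: "linear_map R M M \<alpha>"
    and bs: "bs \<in> tuples M n"
  shows "multilinear_map R M n (tensor_power R M n) (\<lambda>as. twisted_bracket R M n br \<alpha> as bs)"
proof -
  let ?T = "tensor_power R M n"
  interpret T: module R ?T by (rule module_tensor_power)
  note brc = multilinear_map_Cons_closed[OF br _ bs]
  show ?thesis unfolding twisted_bracket_def
  proof (rule multilinear_mapI)
    fix as assume as: "as \<in> tuples M n"
    then show "(\<Oplus>\<^bsub>?T\<^esub>i\<in>{..<n}. tensor R M n ((map \<alpha> as)[i := br (as ! i # bs)])) \<in> carrier ?T"
      by (intro T.M.finsum_closed)
        (auto intro!: tensor_closed tuples_update tuples_map[OF \<alpha>] brc tuples_nth[OF as])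
  next
    fix as j assume as: "as \<in> tuples M n" and j: "j < n"
    show "linear_map R M ?T (\<lambda>x. \<Oplus>\<^bsub>?T\<^esub>i\<in>{..<n}.
        tensor R M n ((map \<alpha> (as[j := x]))[i := br (as[j := x] ! i # bs)]))"
    proof (rule linear_map_sum[OF module_tensor_power])
      fix i assume "i \<in> {..<n}"
      then have i: "i < n" by simp
      show "linear_map R M ?T (\<lambda>x. tensor R M n ((map \<alpha> (as[j := x]))[i := br (as[j := x] ! i # bs)]))"
      proof (cases "i = j")
        case True
        \<comment> \<open>The head \<open>as ! j\<close> is a placeholder, overwritten by the update
          at index 0.\<close>
        have "as ! j # bs \<in> tuples M (Suc n)" using as bs j by (simp add: tuples_Cons tuples_nth)
        from multilinear_map_linear[OF br this, of 0]
        have "linear_map R M M (\<lambda>x. br (x # bs))" by simp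
        from linear_map_comp[OF this multilinear_map_linear[OF multilinear_map_tensor
            tuples_map[OF \<alpha> as] j]]
        show ?thesis using True j tuples_length[OF as] by (simp add: map_update)
      next
        case False
        \<comment> \<open>Here slot \<open>i\<close> is already replaced; slot \<open>j\<close> then
          receives \<open>\<alpha>\<close> of the variable, and the two updates commute because the
          slots differ.\<close>
        have "(map \<alpha> as)[i := br (as ! i # bs)] \<in> tuples M n"
          using as i by (intro tuples_update tuples_map[OF \<alpha>] brc tuples_nth)
        from linear_map_comp[OF \<alpha> multilinear_map_linear[OF multilinear_map_tensor this j]]
        show ?thesis using False by (simp add: map_update list_update_swap)
      qed
    qed simp
  qed
qed

lemma multilinear_map_twisted_bracket_right:
  assumes br: "multilinear_map R M (Suc n) M br" and \<alpha>: "linear_map R M M \<alpha>"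
    and as: "as \<in> tuples M n"
  shows "multilinear_map R M n (tensor_power R M n) (twisted_bracket R M n br \<alpha> as)"
proof -
  let ?T = "tensor_power R M n"
  interpret T: module R ?T by (rule module_tensor_power)
  show ?thesis
  proof (rule multilinear_mapI)
    fix bs assume bs: "bs \<in> tuples M n"
    show "twisted_bracket R M n br \<alpha> as bs \<in> carrier ?T"
      by (rule multilinear_map_closed[OF multilinear_map_twisted_bracket_left[OF br \<alpha> bs] as])
  next
    fix bs j assume bs: "bs \<in> tuples M n" and j: "j < n"
    show "linear_map R M ?T (\<lambda>x. twisted_bracket R M n br \<alpha> as (bs[j := x]))"
      unfolding twisted_bracket_def
    proof (rule linear_map_sum[OF module_tensor_power])
      fix i assume "i \<in> {..<n}"
      then have i: "i < n" by simp
      have "as ! i # bs \<in> tuples M (Suc n)" using as bs i by (simp add: tuples_Cons tuples_nth)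
      \<comment> \<open>Slot \<open>j\<close> of \<open>bs\<close> is slot \<open>Suc j\<close> of
        the argument list of \<open>br\<close>, whose head is \<open>as ! i\<close>.\<close>
      from multilinear_map_linear[OF br this, of "Suc j"] j
      have "linear_map R M M (\<lambda>x. br (as ! i # bs[j := x]))" by simp
      from linear_map_comp[OF this multilinear_map_linear[OF multilinear_map_tensor
          tuples_map[OF \<alpha> as] i]]
      show "linear_map R M ?T (\<lambda>x. tensor R M n ((map \<alpha> as)[i := br (as ! i # bs[j := x])]))" .
    qed simp
  qed
qed

lemma twisted_bracket_extension:
  assumes "multilinear_map R M (Suc n) M br" and "linear_map R M M \<alpha>"
  shows "\<exists>B. extends_bilinearly R M n (twisted_bracket R M n br \<alpha>) B"
  unfolding extends_bilinearly_def
  by (rule tensor_power_bilinear_lift[OF module_tensor_power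
        multilinear_map_twisted_bracket_left[OF assms] multilinear_map_twisted_bracket_right[OF assms]])

lemma tensor_map_extension:
  assumes \<alpha>: "linear_map R M M \<alpha>"
  shows "\<exists>A. extends_linearly R M n (\<lambda>as. tensor R M n (map \<alpha> as)) A"
proof -
  have "multilinear_map R M n (tensor_power R M n) (\<lambda>as. tensor R M n (map \<alpha> as))"
  proof (rule multilinear_mapI)
    fix as i assume "as \<in> tuples M n" "i < n"
    from linear_map_comp[OF \<alpha> multilinear_map_linear[OF multilinear_map_tensor
        tuples_map[OF \<alpha> this(1)] this(2)]]
    show "linear_map R M (tensor_power R M n) (\<lambda>x. tensor R M n (map \<alpha> (as[i := x])))"
      by (simp add: map_update)
  qed (intro tensor_closed tuples_map[OF \<alpha>])
  then show ?thesis
    unfolding extends_linearly_def by (rule tensor_power_lift[OF module_tensor_power]) blast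
qed

end

section \<open>The Leibniz identity on decomposable tensors\<close>

lemma multiplicative_hom_nambu_Cons:
  assumes nambu: "multiplicative_hom_nambu R g (Suc n) br \<alpha>"
    and a: "a \<in> carrier g" and bs: "bs \<in> tuples g n" and cs: "cs \<in> tuples g n"
  shows "br (br (a # bs) # map \<alpha> cs) = br (br (a # cs) # map \<alpha> bs) \<oplus>\<^bsub>g\<^esub>
    (\<Oplus>\<^bsub>g\<^esub>k\<in>{..<n}. br (\<alpha> a # (map \<alpha> bs)[k := br (bs ! k # cs)]))"
proof -
  interpret module R g using nambu by (simp add: multiplicative_hom_nambu_def vectorspace_def)
  have br: "multilinear_map R g (Suc n) g br" and \<alpha>: "linear_map R g g \<alpha>"
    using nambu by (simp_all add: multiplicative_hom_nambu_def)
  note brc = multilinear_map_Cons_closed[OF br]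
  let ?h = "\<lambda>i. br ((map \<alpha> (a # bs))[i := br ((a # bs) ! i # cs)])"
  have h0: "?h 0 \<in> carrier g"
    using a bs cs by (simp add: brc tuples_map[OF \<alpha>])
  have hS: "?h (Suc k) \<in> carrier g" if "k < n" for k
    using a bs cs that by (simp add: brc tuples_map[OF \<alpha>] tuples_update tuples_nth linear_map_closed[OF \<alpha>])
  have "a # bs \<in> tuples g (Suc n)" using a bs by (simp add: tuples_Cons)
  then have "br (br (a # bs) # map \<alpha> cs) = (\<Oplus>\<^bsub>g\<^esub>i\<in>{..<Suc n}. ?h i)"
    using nambu cs by (simp add: multiplicative_hom_nambu_def)
  \<comment> \<open>Index 0 is the term in which \<open>cs\<close> is bracketed with
    \<open>a\<close> itself; the other indices are shifted by one to number the entries of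
    \<open>bs\<close>.\<close>
  also have "{..<Suc n} = insert 0 (Suc ` {..<n})" by (rule lessThan_Suc_eq_insert_0)
  also have "(\<Oplus>\<^bsub>g\<^esub>i\<in>\<dots>. ?h i) = ?h 0 \<oplus>\<^bsub>g\<^esub> (\<Oplus>\<^bsub>g\<^esub>i\<in>Suc ` {..<n}. ?h i)"
    using h0 hS by (intro M.finsum_insert) auto
  also have "(\<Oplus>\<^bsub>g\<^esub>i\<in>Suc ` {..<n}. ?h i) = (\<Oplus>\<^bsub>g\<^esub>k\<in>{..<n}. ?h (Suc k))"
    using hS by (intro M.finsum_reindex) auto
  finally show ?thesis by simp
qed

text \<open>On decomposable tensors both sides expand into double sums. The terms that modify two different
  slots are symmetric in the last two arguments; a slot modified twice gives the Hom-Nambu identity.\<close>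

lemma twisted_bracket_leibniz_tensor:
  assumes nambu: "multiplicative_hom_nambu R g (Suc n) br \<alpha>"
    and B: "extends_bilinearly R g n (twisted_bracket R g n br \<alpha>) B"
    and as: "as \<in> tuples g n" and bs: "bs \<in> tuples g n" and cs: "cs \<in> tuples g n"
  defines "t \<equiv> tensor R g n"
  shows "B (B (t as) (t bs)) (t (map \<alpha> cs)) =
    B (B (t as) (t cs)) (t (map \<alpha> bs)) \<oplus>\<^bsub>tensor_power R g n\<^esub> B (t (map \<alpha> as)) (B (t bs) (t cs))"
proof -
  let ?T = "tensor_power R g n"
  interpret module R g using nambu by (simp add: multiplicative_hom_nambu_def vectorspace_def)
  interpret T: module R ?T by (rule module_tensor_power)
  have br: "multilinear_map R g (Suc n) g br" and \<alpha>: "linear_map R g g \<alpha>"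
    and \<alpha>br: "\<And>xs. xs \<in> tuples g (Suc n) \<Longrightarrow> \<alpha> (br xs) = br (map \<alpha> xs)"
    using nambu by (simp_all add: multiplicative_hom_nambu_def)
  have bil: "bilinear_map R ?T ?T ?T B" using B by (simp add: extends_bilinearly_def)
  have Bt: "B (t us) (t vs) = (\<Oplus>\<^bsub>?T\<^esub>i\<in>{..<n}. t ((map \<alpha> us)[i := br (us ! i # vs)]))"
    if "us \<in> tuples g n" "vs \<in> tuples g n" for us vs
    using B that by (simp add: extends_bilinearly_def twisted_bracket_def t_def)
  note [simp] = multilinear_map_Cons_closed[OF br] tuples_map[OF \<alpha>] tuples_update
    tuples_nth[where M = g and n = n] tuples_length[where M = g and n = n] linear_map_closed[OF \<alpha>]
  \<comment> \<open>Fusing nested maps would block \<open>tuples_map\<close> and the recognition of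
    \<open>a2\<close>.\<close>
  note [simp del] = map_map
  have tc [simp]: "t us \<in> carrier ?T" if "us \<in> tuples g n" for us
    unfolding t_def using that by (rule tensor_closed)
  note [simp] = as bs cs
  define a2 where "a2 = map \<alpha> (map \<alpha> as)"
  have a2 [simp]: "a2 \<in> tuples g n" by (simp add: a2_def)
  \<comment> \<open>\<open>D\<close> modifies slot \<open>i\<close> twice; \<open>X\<close> modifies
    slot \<open>i\<close> with \<open>b\<close> and slot \<open>j\<close> with \<open>c\<close>;
    \<open>Y\<close> brackets slot \<open>i\<close> with the tuple in which \<open>bs ! k\<close>
    has been bracketed with \<open>cs\<close>. Untouched slots carry \<open>\<alpha>\<close> twice,
    hence \<open>a2\<close>. The shape of \<open>X\<close> has multiplicativity built in:
    \<open>\<alpha>\<close> already stands inside the bracket in slot \<open>i\<close>.\<close>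
  define D where "D b c i = t (a2[i := br (br (as ! i # b) # map \<alpha> c)])" for b c i
  define X where "X b c i j = t (a2[i := br (\<alpha> (as ! i) # map \<alpha> b), j := br (\<alpha> (as ! j) # map \<alpha> c)])"
    for b c i j
  define Y where "Y i k = t (a2[i := br (\<alpha> (as ! i) # (map \<alpha> bs)[k := br (bs ! k # cs)])])" for i k
  define S where "S b c = (\<Oplus>\<^bsub>?T\<^esub>i\<in>{..<n}. \<Oplus>\<^bsub>?T\<^esub>j\<in>{..<n}. if i = j then \<zero>\<^bsub>?T\<^esub> else X b c i j)" for b c
  have Dc [simp]: "D b c i \<in> carrier ?T" if "i < n" "b \<in> tuples g n" "c \<in> tuples g n" for b c i
    using that by (simp add: D_def)
  have Xc [simp]: "X b c i j \<in> carrier ?T" if "i < n" "j < n" "b \<in> tuples g n" "c \<in> tuples g n" for b c i j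
    using that by (simp add: X_def)
  have Yc [simp]: "Y i k \<in> carrier ?T" if "i < n" "k < n" for i k
    using that by (simp add: Y_def)
  have Sc [simp]: "S b c \<in> carrier ?T" if "b \<in> tuples g n" "c \<in> tuples g n" for b c
    unfolding S_def using that by (auto intro!: T.M.finsum_closed)
  \<comment> \<open>The tuples \<open>b\<close> and \<open>c\<close> are arbitrary because the
    expansion is used in both orders of \<open>bs\<close> and \<open>cs\<close>.\<close>
  have lhs: "B (B (t as) (t b)) (t (map \<alpha> c)) = (\<Oplus>\<^bsub>?T\<^esub>i\<in>{..<n}. D b c i) \<oplus>\<^bsub>?T\<^esub> S b c"
    if b [simp]: "b \<in> tuples g n" and c [simp]: "c \<in> tuples g n" for b c
  proof -
    have "B (B (t as) (t b)) (t (map \<alpha> c)) =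
        (\<Oplus>\<^bsub>?T\<^esub>i\<in>{..<n}. B (t ((map \<alpha> as)[i := br (as ! i # b)])) (t (map \<alpha> c)))"
      by (simp add: Bt, rule linear_map_finsum[OF module_tensor_power module_tensor_power
            bilinear_map_left[OF bil]]) auto
    also have "\<dots> = (\<Oplus>\<^bsub>?T\<^esub>i\<in>{..<n}. \<Oplus>\<^bsub>?T\<^esub>j\<in>{..<n}. if i = j then D b c i else X b c i j)"
    proof (rule T.M.finsum_cong'[OF refl])
      fix i assume "i \<in> {..<n}"
      then have i [simp]: "i < n" by simp
      let ?u = "(map \<alpha> as)[i := br (as ! i # b)]"
      have "B (t ?u) (t (map \<alpha> c)) =
          (\<Oplus>\<^bsub>?T\<^esub>j\<in>{..<n}. t ((map \<alpha> ?u)[j := br (?u ! j # map \<alpha> c)]))"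
        by (rule Bt) simp_all
      also have "\<dots> = (\<Oplus>\<^bsub>?T\<^esub>j\<in>{..<n}. if i = j then D b c i else X b c i j)"
      proof (rule T.M.finsum_cong'[OF refl])
        fix j assume "j \<in> {..<n}"
        then have [simp]: "j < n" by simp
        show "t ((map \<alpha> ?u)[j := br (?u ! j # map \<alpha> c)]) = (if i = j then D b c i else X b c i j)"
          by (simp add: D_def X_def a2_def map_update \<alpha>br tuples_Cons tuples_length[OF as])
      qed auto
      finally show "B (t ?u) (t (map \<alpha> c)) =
          (\<Oplus>\<^bsub>?T\<^esub>j\<in>{..<n}. if i = j then D b c i else X b c i j)" .
    qed (auto intro!: T.M.finsum_closed)
    also have "\<dots> = (\<Oplus>\<^bsub>?T\<^esub>i\<in>{..<n}. D b c i) \<oplus>\<^bsub>?T\<^esub> S b c"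
      unfolding S_def by (rule T.M.finsum_split_diagonal) auto
    finally show ?thesis .
  qed
  \<comment> \<open>Exchanging the summations and renaming the indices swaps the roles of
    \<open>bs\<close> and \<open>cs\<close>, as updates at distinct slots commute.\<close>
  have "S bs cs = (\<Oplus>\<^bsub>?T\<^esub>j\<in>{..<n}. \<Oplus>\<^bsub>?T\<^esub>i\<in>{..<n}. if i = j then \<zero>\<^bsub>?T\<^esub> else X bs cs i j)"
    unfolding S_def by (rule T.M.finsum_swap) auto
  also have "\<dots> = S cs bs"
    unfolding S_def
    by (intro T.M.finsum_cong' refl) (auto simp: X_def list_update_swap intro!: T.M.finsum_closed)
  finally have S: "S bs cs = S cs bs" .
  \<comment> \<open>The Hom-Nambu identity holds inside slot \<open>i\<close>; linearity of the
    tensor in that slot carries its sum outside.\<close>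
  have D: "D bs cs i = D cs bs i \<oplus>\<^bsub>?T\<^esub> (\<Oplus>\<^bsub>?T\<^esub>k\<in>{..<n}. Y i k)" if i [simp]: "i < n" for i
  proof -
    have lin: "linear_map R g ?T (\<lambda>x. t (a2[i := x]))"
      unfolding t_def by (rule multilinear_map_linear[OF multilinear_map_tensor a2 i])
    have "(\<Oplus>\<^bsub>?T\<^esub>k\<in>{..<n}. Y i k) =
        t (a2[i := \<Oplus>\<^bsub>g\<^esub>k\<in>{..<n}. br (\<alpha> (as ! i) # (map \<alpha> bs)[k := br (bs ! k # cs)])])"
      unfolding Y_def
      by (rule linear_map_finsum[OF module_axioms module_tensor_power lin, symmetric]) auto
    then show ?thesis
      unfolding D_def by (subst multiplicative_hom_nambu_Cons[OF nambu])
        (auto intro!: linear_map_add[OF lin] M.finsum_closed)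
  qed
  have "B (t (map \<alpha> as)) (B (t bs) (t cs)) =
      (\<Oplus>\<^bsub>?T\<^esub>k\<in>{..<n}. B (t (map \<alpha> as)) (t ((map \<alpha> bs)[k := br (bs ! k # cs)])))"
    by (simp add: Bt, rule linear_map_finsum[OF module_tensor_power module_tensor_power
          bilinear_map_right[OF bil]]) auto
  also have "\<dots> = (\<Oplus>\<^bsub>?T\<^esub>k\<in>{..<n}. \<Oplus>\<^bsub>?T\<^esub>i\<in>{..<n}. Y i k)"
  proof (rule T.M.finsum_cong'[OF refl])
    fix k assume "k \<in> {..<n}"
    then have k: "k < n" by simp
    have "B (t (map \<alpha> as)) (t ((map \<alpha> bs)[k := br (bs ! k # cs)])) =
        (\<Oplus>\<^bsub>?T\<^esub>i\<in>{..<n}. t ((map \<alpha> (map \<alpha> as))[i :=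
          br (map \<alpha> as ! i # (map \<alpha> bs)[k := br (bs ! k # cs)])]))"
      by (rule Bt) (simp_all add: k)
    also have "\<dots> = (\<Oplus>\<^bsub>?T\<^esub>i\<in>{..<n}. Y i k)"
      by (intro T.M.finsum_cong' refl) (auto simp: k Y_def a2_def)
    finally show "B (t (map \<alpha> as)) (t ((map \<alpha> bs)[k := br (bs ! k # cs)])) = (\<Oplus>\<^bsub>?T\<^esub>i\<in>{..<n}. Y i k)" .
  qed (auto intro!: T.M.finsum_closed)
  \<comment> \<open>The expansion has the entries of \<open>bs\<close> as outer index; the slot
    index must be outermost to match the sums of \<open>D\<close>.\<close>
  also have "\<dots> = (\<Oplus>\<^bsub>?T\<^esub>i\<in>{..<n}. \<Oplus>\<^bsub>?T\<^esub>k\<in>{..<n}. Y i k)"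
    by (rule T.M.finsum_swap) auto
  finally have rhs: "B (t (map \<alpha> as)) (B (t bs) (t cs)) = (\<Oplus>\<^bsub>?T\<^esub>i\<in>{..<n}. \<Oplus>\<^bsub>?T\<^esub>k\<in>{..<n}. Y i k)" .
  have "(\<Oplus>\<^bsub>?T\<^esub>i\<in>{..<n}. D bs cs i) = (\<Oplus>\<^bsub>?T\<^esub>i\<in>{..<n}. D cs bs i \<oplus>\<^bsub>?T\<^esub> (\<Oplus>\<^bsub>?T\<^esub>k\<in>{..<n}. Y i k))"
    by (intro T.M.finsum_cong' refl) (auto simp: D intro!: T.M.finsum_closed T.M.a_closed)
  also have "\<dots> = (\<Oplus>\<^bsub>?T\<^esub>i\<in>{..<n}. D cs bs i) \<oplus>\<^bsub>?T\<^esub> (\<Oplus>\<^bsub>?T\<^esub>i\<in>{..<n}. \<Oplus>\<^bsub>?T\<^esub>k\<in>{..<n}. Y i k)"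
    by (rule T.M.finsum_addf) (auto intro!: T.M.finsum_closed)
  finally show ?thesis
    by (simp add: lhs rhs S T.M.a_ac T.M.finsum_closed Pi_iff)
qed

text \<open>Since \<open>tensor_power_eqI\<close> frees a single variable, the identities pass from
  decomposable tensors to all elements one argument at a time, starting from the last. With the
  other arguments fixed, both sides are linear in the one being freed.\<close>

lemma twisted_bracket_hom_leibniz:
  assumes nambu: "multiplicative_hom_nambu R g (Suc n) br \<alpha>"
    and B: "extends_bilinearly R g n (twisted_bracket R g n br \<alpha>) B"
    and A: "extends_linearly R g n (\<lambda>as. tensor R g n (map \<alpha> as)) A"
  shows "multiplicative_hom_leibniz R (tensor_power R g n) B A"
proof -
  let ?T = "tensor_power R g n" and ?t = "tensor R g n"
  have vs: "field R" "module R g"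
    using nambu by (simp_all add: multiplicative_hom_nambu_def vectorspace_def)
  interpret module R g by fact
  have T: "module R ?T" by (rule module_tensor_power)
  have br: "multilinear_map R g (Suc n) g br" and \<alpha>: "linear_map R g g \<alpha>"
    and \<alpha>br: "\<And>xs. xs \<in> tuples g (Suc n) \<Longrightarrow> \<alpha> (br xs) = br (map \<alpha> xs)"
    using nambu by (simp_all add: multiplicative_hom_nambu_def)
  have bil: "bilinear_map R ?T ?T ?T B"
    and Bt: "\<And>as bs. as \<in> tuples g n \<Longrightarrow> bs \<in> tuples g n \<Longrightarrow>
      B (?t as) (?t bs) = twisted_bracket R g n br \<alpha> as bs"
    using B by (simp_all add: extends_bilinearly_def)
  have lin: "linear_map R ?T ?T A" and At: "\<And>as. as \<in> tuples g n \<Longrightarrow> A (?t as) = ?t (map \<alpha> as)"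
    using A by (simp_all add: extends_linearly_def)
  note Bl = bilinear_map_left[OF bil] and Br = bilinear_map_right[OF bil]
  note closed [simp] = bilinear_map_closed[OF bil] linear_map_closed[OF lin] tensor_closed
  note comp = linear_map_comp and plus = linear_map_plus[OF T] and eqI = tensor_power_eqI[OF T]
  have leib1: "B (B (?t as) (?t bs)) (A z) = B (B (?t as) z) (A (?t bs)) \<oplus>\<^bsub>?T\<^esub> B (A (?t as)) (B (?t bs) z)"
    if as: "as \<in> tuples g n" and bs: "bs \<in> tuples g n" and z: "z \<in> carrier ?T" for as bs z
  proof (rule eqI[OF _ _ _ z])
    show "linear_map R ?T ?T (\<lambda>z. B (B (?t as) (?t bs)) (A z))"
      using as bs by (intro comp[OF lin Br]) simp
    show "linear_map R ?T ?T (\<lambda>z. B (B (?t as) z) (A (?t bs)) \<oplus>\<^bsub>?T\<^esub> B (A (?t as)) (B (?t bs) z))"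
      using as bs by (intro plus comp[OF Br Bl] comp[OF Br Br]) simp_all
    show "B (B (?t as) (?t bs)) (A (?t cs)) =
        B (B (?t as) (?t cs)) (A (?t bs)) \<oplus>\<^bsub>?T\<^esub> B (A (?t as)) (B (?t bs) (?t cs))"
      if "cs \<in> tuples g n" for cs
      using twisted_bracket_leibniz_tensor[OF nambu B as bs that] that as bs by (simp add: At)
  qed
  have leib2: "B (B (?t as) y) (A z) = B (B (?t as) z) (A y) \<oplus>\<^bsub>?T\<^esub> B (A (?t as)) (B y z)"
    if as: "as \<in> tuples g n" and y: "y \<in> carrier ?T" and z: "z \<in> carrier ?T" for as y z
  proof (rule eqI[OF _ _ _ y])
    show "linear_map R ?T ?T (\<lambda>y. B (B (?t as) y) (A z))"
      using as z by (intro comp[OF Br Bl]) simp_all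
    show "linear_map R ?T ?T (\<lambda>y. B (B (?t as) z) (A y) \<oplus>\<^bsub>?T\<^esub> B (A (?t as)) (B y z))"
      using as z by (intro plus comp[OF lin Br] comp[OF Bl Br]) simp_all
  qed (rule leib1[OF as _ z])
  have leib: "B (B x y) (A z) = B (B x z) (A y) \<oplus>\<^bsub>?T\<^esub> B (A x) (B y z)"
    if x: "x \<in> carrier ?T" and y: "y \<in> carrier ?T" and z: "z \<in> carrier ?T" for x y z
  proof (rule eqI[OF _ _ _ x])
    show "linear_map R ?T ?T (\<lambda>x. B (B x y) (A z))"
      using y z by (intro comp[OF Bl Bl]) simp_all
    show "linear_map R ?T ?T (\<lambda>x. B (B x z) (A y) \<oplus>\<^bsub>?T\<^esub> B (A x) (B y z))"
      using y z by (intro plus comp[OF Bl Bl] comp[OF lin Bl]) simp_all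
  qed (rule leib2[OF _ y z])
  \<comment> \<open>In slot \<open>i\<close> of the \<open>i\<close>-th summand this is
    multiplicativity of \<open>\<alpha>\<close> with respect to \<open>br\<close>; every other slot
    carries \<open>\<alpha>\<close> twice on both sides.\<close>
  have mult0: "A (B (?t as) (?t bs)) = B (A (?t as)) (A (?t bs))"
    if as: "as \<in> tuples g n" and bs: "bs \<in> tuples g n" for as bs
  proof -
    interpret T: module R ?T by (rule T)
    note [simp] = multilinear_map_Cons_closed[OF br] tuples_map[OF \<alpha>] tuples_update
      tuples_nth[where M = g and n = n]
    have "A (B (?t as) (?t bs)) = (\<Oplus>\<^bsub>?T\<^esub>i\<in>{..<n}. A (?t ((map \<alpha> as)[i := br (as ! i # bs)])))"
      using as bs by (simp add: Bt twisted_bracket_def)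
        (rule linear_map_finsum[OF T T lin], auto)
    also have "\<dots> = (\<Oplus>\<^bsub>?T\<^esub>i\<in>{..<n}. ?t ((map \<alpha> (map \<alpha> as))[i := br (map \<alpha> as ! i # map \<alpha> bs)]))"
      using as bs
      by (intro T.M.finsum_cong' refl)
        (auto simp: At map_update \<alpha>br tuples_Cons tuples_length[OF as] linear_map_closed[OF \<alpha>]
          simp del: map_map)
    also have "\<dots> = B (A (?t as)) (A (?t bs))"
      using as bs by (simp add: At Bt twisted_bracket_def)
    finally show ?thesis .
  qed
  have mult1: "A (B (?t as) y) = B (A (?t as)) (A y)"
    if as: "as \<in> tuples g n" and y: "y \<in> carrier ?T" for as y
    by (rule eqI[OF comp[OF Br lin] comp[OF lin Br] _ y]) (use as mult0 in simp_all)
  have mult: "A (B x y) = B (A x) (A y)" if x: "x \<in> carrier ?T" and y: "y \<in> carrier ?T" for x y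
    by (rule eqI[OF comp[OF Bl lin] comp[OF lin Bl] _ x]) (use y mult1 in simp_all)
  show ?thesis
    unfolding multiplicative_hom_leibniz_def vectorspace_def
    by (intro conjI ballI vs(1) T bil lin leib mult)
qed

lemma derivation_bracket_eq_twisted: "derivation_bracket R g n br = twisted_bracket R g n br (\<lambda>x. x)"
  by (intro ext) (simp add: derivation_bracket_def twisted_bracket_def)

text \<open>An extension is determined on the carrier only, so each part asserts that extensions
  exist and that all of them have the stated property. The Leibniz conclusion is conditional on the
  identity for the identity map because the untwisted bracket leaves no \<open>\<alpha>\<close> in
  the slots it modifies twice.\<close>

theorem theorem4p8:
  fixes R :: "('r, 'x) ring_scheme" and g :: "('r, 'a, 'y) module_scheme"
    and n :: nat and br :: "'a list \<Rightarrow> 'a" and \<alpha> :: "'a \<Rightarrow> 'a"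
  assumes "n \<ge> 1" and "multiplicative_hom_nambu R g (n + 1) br \<alpha>"
  shows
    "((\<exists>B. extends_bilinearly R g n (derivation_bracket R g n br) B) \<and>
      (\<forall>B. extends_bilinearly R g n (derivation_bracket R g n br) B \<longrightarrow>
         multiplicative_hom_nambu R g (n + 1) br (\<lambda>x. x) \<longrightarrow>
         leibniz_algebra R (tensor_power R g n) B)) \<and>
     ((\<exists>B. extends_bilinearly R g n (twisted_bracket R g n br \<alpha>) B) \<and>
      (\<exists>A. extends_linearly R g n (\<lambda>as. tensor R g n (map \<alpha> as)) A) \<and>
      (\<forall>B A. extends_bilinearly R g n (twisted_bracket R g n br \<alpha>) B \<longrightarrow>
         extends_linearly R g n (\<lambda>as. tensor R g n (map \<alpha> as)) A \<longrightarrow>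
         multiplicative_hom_leibniz R (tensor_power R g n) B A))"
proof -
  have nambu: "multiplicative_hom_nambu R g (Suc n) br \<alpha>" using assms(2) by simp
  interpret module R g using nambu by (simp add: multiplicative_hom_nambu_def vectorspace_def)
  have br: "multilinear_map R g (Suc n) g br" and \<alpha>: "linear_map R g g \<alpha>"
    using nambu by (simp_all add: multiplicative_hom_nambu_def)
  \<comment> \<open>For the identity twisting map the identity is an admissible extension, and with
    it the Hom-Leibniz identity becomes the Leibniz identity.\<close>
  have id: "extends_linearly R g n (\<lambda>as. tensor R g n (map (\<lambda>x. x) as)) (\<lambda>x. x)"
    by (simp add: extends_linearly_def linear_map_id)
  have "leibniz_algebra R (tensor_power R g n) B"
    if "extends_bilinearly R g n (derivation_bracket R g n br) B"
      and "multiplicative_hom_nambu R g (Suc n) br (\<lambda>x. x)" for B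
    using twisted_bracket_hom_leibniz[OF that(2) that(1)[unfolded derivation_bracket_eq_twisted] id]
    unfolding leibniz_algebra_def multiplicative_hom_leibniz_def by blast
  then show ?thesis
    using twisted_bracket_extension[OF br linear_map_id] twisted_bracket_extension[OF br \<alpha>]
      tensor_map_extension[OF \<alpha>] twisted_bracket_hom_leibniz[OF nambu]
    by (simp add: derivation_bracket_eq_twisted)
qed

end
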